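(* The set of triples $(R,S,t)$ ($R,S$ finite TRSs, $t$ a term) such that $\mathrm{SN}(\to_{\epsilon,R}/\to_S)$ holds on $t$ is $\Pi^1_1$-complete, and the set of pairs $(R,S)$ such that $\mathrm{SN}(\to_{\epsilon,R}/\to_S)$ holds (on all terms) is $\Pi^1_1$-complete. Moreover, $\Pi^1_1$-hardness holds already when restricted to the case $R=S$ (i.e. for the sets $\{(S,t)\mid \mathrm{SN}(\to_{\epsilon,S}/\to_S)\text{ on }t\}$ and $\{S\mid \mathrm{SN}(\to_{\epsilon,S}/\to_S)\}$).
   Context: All TRSs are finite over a finite signature. $\to_{\epsilon,R}$ denotes a rewrite step with a rule of $R$ applied at the root position (no surrounding context). For relations $\to_1,\to_2$, $\to_1/\to_2$ denotes $\to_2^*\cdot\to_1$. $\mathrm{SN}(\to_{\epsilon,R}/\to_S)$ holds on $t$ if there is no infinite sequence $t=t_0,t_1,t_2,\dots$ with $t_i\to_S^*\cdot\to_{\epsilon,R} t_{i+1}$ for all $i$, equivalently every $(\to_{\epsilon,R}\cup\to_S)$-reduction starting from $t$ contains only finitely many $\to_{\epsilon,R}$-steps; it holds (uniformly) if it holds on every term (this is finiteness of the dependency pair problem $\{R,S\}$). TRSs and terms are encoded as natural numbers by a standard Gödel numbering. $\Pi^1_1$ is the class of sets definable by a formula $\forall\alpha\,\varphi$ with $\alpha$ ranging over functions $\mathbb N\to\mathbb N$ and $\varphi$ arithmetical; $B$ is $\Pi^1_1$-complete if $B\in\Pi^1_1$ and every $\Pi^1_1$ set many-one reduces to $B$ via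 a total computable function. *)

theory Defs
  imports Main "HOL-Library.Nat_Bijection"
begin

text \<open>Terms over function symbols and variables both represented by natural numbers.
  A symbol applied to n arguments is an n-ary symbol; any concrete TRS together with a
  term mentions only finitely many symbols, i.e. lives over a finite signature.\<close>

datatype trm = Var nat | Fun nat "trm list"

fun subst :: "(nat \<Rightarrow> trm) \<Rightarrow> trm \<Rightarrow> trm" where
  "subst \<sigma> (Var x) = \<sigma> x"
| "subst \<sigma> (Fun f ts) = Fun f (map (subst \<sigma>) ts)"

fun vars :: "trm \<Rightarrow> nat set" where
  "vars (Var x) = {x}"
| "vars (Fun f ts) = (\<Union>t\<in>set ts. vars t)"

type_synonym trs = "(trm \<times> trm) list"

definition wf_trs :: "trs \<Rightarrow> bool" where
  "wf_trs R \<longleftrightarrow> (\<forall>(l, r) \<in> set R. (\<exists>f ts. l = Fun f ts) \<and> vars r \<subseteq> vars l)"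

definition root_step :: "trs \<Rightarrow> trm \<Rightarrow> trm \<Rightarrow> bool" where
  "root_step R s t \<longleftrightarrow> (\<exists>(l, r) \<in> set R. \<exists>\<sigma>. s = subst \<sigma> l \<and> t = subst \<sigma> r)"

inductive rstep :: "trs \<Rightarrow> trm \<Rightarrow> trm \<Rightarrow> bool" for R where
  root: "root_step R s t \<Longrightarrow> rstep R s t"
| ctxt: "rstep R s t \<Longrightarrow> rstep R (Fun f (ss1 @ s # ss2)) (Fun f (ss1 @ t # ss2))"

definition SN_rel_on :: "trs \<Rightarrow> trs \<Rightarrow> trm \<Rightarrow> bool" where
  "SN_rel_on R S t \<longleftrightarrow>
     \<not> (\<exists>f :: nat \<Rightarrow> trm. f 0 = t \<and> (\<forall>i. ((rstep S)\<^sup>*\<^sup>* OO root_step R) (f i) (f (Suc i))))"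

definition SN_rel :: "trs \<Rightarrow> trs \<Rightarrow> bool" where
  "SN_rel R S \<longleftrightarrow> (\<forall>t. SN_rel_on R S t)"

fun enc_trm :: "trm \<Rightarrow> nat" where
  "enc_trm (Var x) = prod_encode (0, x)"
| "enc_trm (Fun f ts) = prod_encode (1, prod_encode (f, list_encode (map enc_trm ts)))"

definition enc_trs :: "trs \<Rightarrow> nat" where
  "enc_trs R = list_encode (map (\<lambda>(l, r). prod_encode (enc_trm l, enc_trm r)) R)"

datatype recf = Zf | Sf | Id nat | Cn recf "recf list" | Pr recf recf | Mn recf

inductive reval :: "recf \<Rightarrow> nat list \<Rightarrow> nat \<Rightarrow> bool" where
  "reval Zf xs 0"
| "reval Sf (x # xs) (Suc x)"
| "i < length xs \<Longrightarrow> reval (Id i) xs (xs ! i)"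
| "length ys = length gs \<Longrightarrow> (\<forall>i < length gs. reval (gs ! i) xs (ys ! i)) \<Longrightarrow>
     reval f ys z \<Longrightarrow> reval (Cn f gs) xs z"
| "reval f xs y \<Longrightarrow> reval (Pr f g) (0 # xs) y"
| "reval (Pr f g) (n # xs) y \<Longrightarrow> reval g (n # y # xs) z \<Longrightarrow> reval (Pr f g) (Suc n # xs) z"
| "reval f (n # xs) 0 \<Longrightarrow> (\<forall>m < n. \<exists>y. reval f (m # xs) (Suc y)) \<Longrightarrow> reval (Mn f) xs n"

definition computable :: "(nat \<Rightarrow> nat) \<Rightarrow> bool" where
  "computable h \<longleftrightarrow> (\<exists>c. \<forall>n. reval c [n] (h n))"

datatype atrm = V nat | Zer | Sc atrm | Pl atrm atrm | Tm atrm atrm | Ap atrm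

datatype afm = Eq atrm atrm | Neg afm | Conj afm afm | Ex afm

fun aval :: "(nat \<Rightarrow> nat) \<Rightarrow> nat list \<Rightarrow> atrm \<Rightarrow> nat" where
  "aval \<alpha> e (V i) = e ! i"
| "aval \<alpha> e Zer = 0"
| "aval \<alpha> e (Sc t) = Suc (aval \<alpha> e t)"
| "aval \<alpha> e (Pl t u) = aval \<alpha> e t + aval \<alpha> e u"
| "aval \<alpha> e (Tm t u) = aval \<alpha> e t * aval \<alpha> e u"
| "aval \<alpha> e (Ap t) = \<alpha> (aval \<alpha> e t)"

fun asat :: "(nat \<Rightarrow> nat) \<Rightarrow> nat list \<Rightarrow> afm \<Rightarrow> bool" where
  "asat \<alpha> e (Eq t u) = (aval \<alpha> e t = aval \<alpha> e u)"
| "asat \<alpha> e (Neg \<phi>) = (\<not> asat \<alpha> e \<phi>)"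
| "asat \<alpha> e (Conj \<phi> \<psi>) = (asat \<alpha> e \<phi> \<and> asat \<alpha> e \<psi>)"
| "asat \<alpha> e (Ex \<phi>) = (\<exists>n. asat \<alpha> (n # e) \<phi>)"

definition Pi11 :: "nat set \<Rightarrow> bool" where
  "Pi11 B \<longleftrightarrow> (\<exists>\<phi>. \<forall>n. n \<in> B \<longleftrightarrow> (\<forall>\<alpha>. asat \<alpha> [n] \<phi>))"

definition Pi11_hard :: "nat set \<Rightarrow> bool" where
  "Pi11_hard B \<longleftrightarrow> (\<forall>A. Pi11 A \<longrightarrow> (\<exists>h. computable h \<and> (\<forall>n. n \<in> A \<longleftrightarrow> h n \<in> B)))"

definition Pi11_complete :: "nat set \<Rightarrow> bool" where
  "Pi11_complete B \<longleftrightarrow> Pi11 B \<and> Pi11_hard B"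

definition SN_triples :: "nat set" where
  "SN_triples = {prod_encode (enc_trs R, prod_encode (enc_trs S, enc_trm t)) | R S t.
                  wf_trs R \<and> wf_trs S \<and> SN_rel_on R S t}"

definition SN_pairs :: "nat set" where
  "SN_pairs = {prod_encode (enc_trs R, enc_trs S) | R S. wf_trs R \<and> wf_trs S \<and> SN_rel R S}"

definition SN_self_on :: "nat set" where
  "SN_self_on = {prod_encode (enc_trs S, enc_trm t) | S t. wf_trs S \<and> SN_rel_on S S t}"

definition SN_self :: "nat set" where
  "SN_self = {enc_trs S | S. wf_trs S \<and> SN_rel S S}"

end

theory Submission
  imports Defs
begin

text \<open>Hardness. Let \<open>A = {n. \<forall>\<alpha>. \<phi>(\<alpha>, n)}\<close> with \<open>\<phi>\<close> arithmetical. The rewrite system for \<open>n\<close> searches for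
  \<open>\<alpha>\<close> with \<open>\<not> \<phi>(\<alpha>, n)\<close> like a systematic tableau: it keeps a queue of goals (a formula is true or
  false, a term has a given value) and a finite part of \<open>\<alpha>\<close>. Each root step replaces a
  goal by simpler ones, guessing witnesses, summands and further values of \<open>\<alpha>\<close> by rewriting below the
  root; a false existential formula is replaced by its infinitely many instances, one after the other.
  An infinite run treats every goal, so its limit is an \<open>\<alpha>\<close> falsifying \<open>\<phi>\<close>; conversely such an \<open>\<alpha>\<close>
  guides an infinite run. Since all guessing is hidden below the root, no other reduction has
  infinitely many root steps.

  Membership. Being a term, substitution, one-step rewriting and so on are determined on codes by
  fixpoint equations. So \<open>SN\<close> says: whenever \<open>\<alpha>\<close> satisfies these equations, the codes are valid and
  the sequence stored in another section of \<open>\<alpha>\<close> is not an infinite reduction.\<close>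

section \<open>Computable functions and injectivity of the encodings\<close>

text \<open>Two obstacles shape the hardness half. For \<open>R = S\<close> the rules that guess
  below the root can also fire at the root, and uniform termination concerns arbitrary starting
  terms, whose queues and memory may be junk containing redexes. Hence all unbounded work sits below
  a symbol \<open>run\<close> that the guessing rules do not match, and the guesses are reset to
  zero after each such root step. The goals operate on formulas directly, so no normal form of
  \<phi> has to be computed: the input enters the system only as one numeral, which makes the
  reduction easily computable. In the membership half, defining substitution or reachability inside
  arithmetic would require a coding of finite sequences in the formula language. Letting \<alpha>
  carry these predicates avoids that; what remains to be shown is that solutions of the equations
  agree with the intended notions on valid codes, and that a solution exists for every choice of the
  stored sequence.\<close>

lemma reval_Cn1: "reval g xs y \<Longrightarrow> reval f [y] z \<Longrightarrow> reval (Cn f [g]) xs z"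
  by (rule reval.intros(4)[where ys = "[y]"]) auto

lemma reval_Cn2:
  "reval g xs y \<Longrightarrow> reval g' xs y' \<Longrightarrow> reval f [y, y'] z \<Longrightarrow> reval (Cn f [g, g']) xs z"
  by (rule reval.intros(4)[where ys = "[y, y']"]) (auto simp: less_Suc_eq)

lemma reval_Id: "i < length xs \<Longrightarrow> y = xs ! i \<Longrightarrow> reval (Id i) xs y"
  by (simp add: reval.intros(3))

definition rec_add :: recf where
  "rec_add = Pr (Id 0) (Cn Sf [Id 1])"

lemma reval_add: "reval rec_add [a, b] (a + b)"
proof (induction a)
  case 0
  then show ?case
    unfolding rec_add_def by (simp add: reval.intros(5) reval_Id)
next
  case (Suc a)
  have "reval (Cn Sf [Id 1]) [a, a + b, b] (Suc a + b)"
    by (rule reval_Cn1[OF reval_Id]) (auto intro: reval.intros(2))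
  then show ?case
    using Suc unfolding rec_add_def by (auto intro: reval.intros(6))
qed

definition rec_triangle :: recf where
  "rec_triangle = Pr Zf (Cn rec_add [Cn Sf [Id 0], Id 1])"

lemma reval_triangle: "reval rec_triangle [a] (triangle a)"
proof (induction a)
  case 0
  then show ?case
    unfolding rec_triangle_def by (auto intro: reval.intros(1,5))
next
  case (Suc a)
  have "reval (Cn rec_add [Cn Sf [Id 0], Id 1]) [a, triangle a] (Suc a + triangle a)"
    by (rule reval_Cn2[OF reval_Cn1[OF reval_Id reval.intros(2)] reval_Id reval_add]) auto
  then show ?case
    using Suc unfolding rec_triangle_def by (auto intro: reval.intros(6) simp: add.commute)
qed

definition rec_pair :: recf where
  "rec_pair = Cn rec_add [Cn rec_triangle [rec_add], Id 0]"

lemma reval_pair: "reval rec_pair [a, b] (prod_encode (a, b))"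
  unfolding rec_pair_def prod_encode_def
  by (auto intro: reval_Cn2[OF reval_Cn1[OF reval_add reval_triangle] reval_Id reval_add])

lemma reval_const: "\<exists>c. \<forall>xs. reval c xs k"
proof (induction k)
  case 0
  then show ?case by (blast intro: reval.intros(1))
next
  case (Suc k)
  then show ?case by (blast intro: reval_Cn1 reval.intros(2))
qed

lemma computable_const: "computable (\<lambda>n. k)"
  using reval_const unfolding computable_def by blast

lemma computable_Suc: "computable f \<Longrightarrow> computable (\<lambda>n. Suc (f n))"
  unfolding computable_def by (blast intro: reval_Cn1 reval.intros(2))

lemma computable_pair:
  "computable f \<Longrightarrow> computable g \<Longrightarrow> computable (\<lambda>n. prod_encode (f n, g n))"
  unfolding computable_def by (blast intro: reval_Cn2 reval_pair)

text \<open>Primitive recursion that ignores its counter. It serves to encode numerals, whose codes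
  are iterates of the code of one successor.\<close>

lemma computable_iterate:
  assumes "computable f"
  shows "computable (\<lambda>n. (f ^^ n) k)"
proof -
  obtain c where c: "\<And>n. reval c [n] (f n)"
    using assms unfolding computable_def by blast
  obtain d where d: "\<And>xs. reval d xs k"
    using reval_const by blast
  have "reval (Pr d (Cn c [Id 1])) [n] ((f ^^ n) k)" for n
  proof (induction n)
    case 0
    then show ?case by (auto intro: reval.intros(5) d)
  next
    case (Suc n)
    have "reval (Cn c [Id 1]) [n, (f ^^ n) k] (f ((f ^^ n) k))"
      by (rule reval_Cn1[OF reval_Id c]) auto
    then show ?case using Suc by (auto intro: reval.intros(6))
  qed
  then show ?thesis
    unfolding computable_def by blast
qed

text \<open>The sets of instances are images of encodings; injectivity keeps a code outside such a
  set from having a second decoding inside it.\<close>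

lemma enc_trm_inject: "enc_trm s = enc_trm t \<longleftrightarrow> s = t"
proof
  show "enc_trm s = enc_trm t \<Longrightarrow> s = t"
  proof (induction s arbitrary: t)
    case (Var x)
    then show ?case by (cases t) auto
  next
    case (Fun f ss)
    then obtain ts where t: "t = Fun f ts" and "map enc_trm ss = map enc_trm ts"
      by (cases t) (auto simp: list_encode_eq)
    then have "ss = ts"
      using Fun.IH by (intro list.inj_map_strong[of ss ts enc_trm enc_trm]) auto
    then show ?case by (simp add: t)
  qed
qed simp

lemma enc_trs_inject: "enc_trs R = enc_trs S \<longleftrightarrow> R = S"
proof -
  have "inj (\<lambda>(l, r). prod_encode (enc_trm l, enc_trm r))"
    by (auto simp: inj_def enc_trm_inject)
  then show ?thesis
    unfolding enc_trs_def by (simp add: list_encode_eq)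
qed

section \<open>A rewrite system searching for a falsifying function\<close>

abbreviation "tZ \<equiv> Fun 0 []"
abbreviation "tS x \<equiv> Fun 8 [x]"
abbreviation "tNil \<equiv> Fun 2 []"
abbreviation "tCons x y \<equiv> Fun 3 [x, y]"

text \<open>A configuration \<open>mach [F, B, N, L, g, h]\<close> or \<open>ok [F, B, N, L, g, h]\<close> consists of the goals
  \<open>F\<close> of the current batch, the goals \<open>B\<close> of the next batch, the values \<open>\<alpha> (N - 1), \<dots>, \<alpha> 0\<close>
  committed so far as the list \<open>L\<close> with length \<open>N\<close>, and two guessed numbers \<open>g\<close> and \<open>h\<close>. Guessing
  leaves a \<open>wrap\<close> on top, so that it can take place arbitrarily often below \<open>run\<close>, but only
  boundedly often at the root of a term.\<close>

abbreviation "mach ts \<equiv> Fun 4 ts"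
abbreviation "wrap t \<equiv> Fun 5 [t]"
abbreviation "run t \<equiv> Fun 6 [t]"
abbreviation "ok ts \<equiv> Fun 7 ts"

abbreviation "cV i \<equiv> Fun 10 [i]"
abbreviation "cZ \<equiv> Fun 11 []"
abbreviation "cS t \<equiv> Fun 12 [t]"
abbreviation "cP t u \<equiv> Fun 13 [t, u]"
abbreviation "cT t u \<equiv> Fun 14 [t, u]"
abbreviation "cA t \<equiv> Fun 15 [t]"
abbreviation "cEq t u \<equiv> Fun 16 [t, u]"
abbreviation "cNeg p \<equiv> Fun 17 [p]"
abbreviation "cConj p q \<equiv> Fun 18 [p, q]"
abbreviation "cEx p \<equiv> Fun 19 [p]"

text \<open>\<open>gLook k v N L\<close> claims that \<open>v\<close> is the \<open>k\<close>-th value from the end of the list \<open>L\<close> of length \<open>N\<close>,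
  and \<open>gAll p e w\<close> that \<open>p\<close> fails for all values of its first variable from \<open>w\<close> on.\<close>

abbreviation "gVal t e v \<equiv> Fun 20 [t, e, v]"
abbreviation "gTru p e \<equiv> Fun 21 [p, e]"
abbreviation "gFls p e \<equiv> Fun 22 [p, e]"
abbreviation "gAdd x y z \<equiv> Fun 23 [x, y, z]"
abbreviation "gMul x y z \<equiv> Fun 24 [x, y, z]"
abbreviation "gLook k v N L \<equiv> Fun 25 [k, v, N, L]"
abbreviation "gNeq x y \<equiv> Fun 26 [x, y]"
abbreviation "gAll p e w \<equiv> Fun 27 [p, e, w]"

text \<open>Wrong guesses end in a false goal such as \<open>gNeq tZ tZ\<close>, which matches no
  rule and halts the machine once it heads the queue. Disjunctive choices are overlapping rules;
  numerical witnesses come from \<open>g\<close> and \<open>h\<close>.\<close>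

inductive goal_step :: "trm \<Rightarrow> trm \<Rightarrow> trm \<Rightarrow> trm \<Rightarrow> trm \<Rightarrow> trm list \<Rightarrow> bool"
  for N L g h where
  V_0: "goal_step N L g h (gVal (cV tZ) (tCons a b) a) []"
| V_S: "goal_step N L g h (gVal (cV (tS i)) (tCons x e) v) [gVal (cV i) e v]"
| Zer: "goal_step N L g h (gVal cZ e tZ) []"
| Sc: "goal_step N L g h (gVal (cS t) e (tS v)) [gVal t e v]"
| Pl: "goal_step N L g h (gVal (cP t u) e v) [gVal t e g, gVal u e h, gAdd g h v]"
| Tm: "goal_step N L g h (gVal (cT t u) e v) [gVal t e g, gVal u e h, gMul g h v]"
| Ap: "goal_step N L g h (gVal (cA t) e v) [gVal t e g, gLook g v N L]"
| Add_0: "goal_step N L g h (gAdd tZ y y) []"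
| Add_S: "goal_step N L g h (gAdd (tS x) y (tS z)) [gAdd x y z]"
| Mul_0: "goal_step N L g h (gMul tZ y tZ) []"
| Mul_S: "goal_step N L g h (gMul (tS x) y z) [gMul x y g, gAdd g y z]"
| Look_hit: "goal_step N L g h (gLook k v (tS k) (tCons v M)) []"
| Look_next: "goal_step N L g h (gLook k v (tS j) (tCons x M)) [gLook k v j M]"
| Neq_0S: "goal_step N L g h (gNeq tZ (tS y)) []"
| Neq_S0: "goal_step N L g h (gNeq (tS x) tZ) []"
| Neq_SS: "goal_step N L g h (gNeq (tS x) (tS y)) [gNeq x y]"
| Tru_Eq: "goal_step N L g h (gTru (cEq t u) e) [gVal t e g, gVal u e g]"
| Fls_Eq: "goal_step N L g h (gFls (cEq t u) e) [gVal t e g, gVal u e h, gNeq g h]"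
| Tru_Neg: "goal_step N L g h (gTru (cNeg p) e) [gFls p e]"
| Fls_Neg: "goal_step N L g h (gFls (cNeg p) e) [gTru p e]"
| Tru_Conj: "goal_step N L g h (gTru (cConj p q) e) [gTru p e, gTru q e]"
| Fls_Conj1: "goal_step N L g h (gFls (cConj p q) e) [gFls p e]"
| Fls_Conj2: "goal_step N L g h (gFls (cConj p q) e) [gFls q e]"
| Tru_Ex: "goal_step N L g h (gTru (cEx p) e) [gTru p (tCons g e)]"
| Fls_Ex: "goal_step N L g h (gFls (cEx p) e) [gAll p e tZ]"
| All: "goal_step N L g h (gAll p e w) [gFls p (tCons w e), gAll p e (tS w)]"

text \<open>Variables 0 to 5 are reserved for F, B, N, L, g, h in this order. A right-hand side may
  mention 2 to 5 although its goal does not, since the surrounding \<open>ok\<close> pattern binds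
  them.\<close>

definition goal_rules :: "(trm \<times> trm list) list" where
  "goal_rules =
  [   (gVal (cV tZ) (tCons (Var 6) (Var 7)) (Var 6), []),
   (gVal (cV (tS (Var 6))) (tCons (Var 7) (Var 8)) (Var 9), [gVal (cV (Var 6)) (Var 8) (Var 9)]),
   (gVal cZ (Var 6) tZ, []),
   (gVal (cS (Var 6)) (Var 7) (tS (Var 8)), [gVal (Var 6) (Var 7) (Var 8)]),
   (gVal (cP (Var 6) (Var 7)) (Var 8) (Var 9), [gVal (Var 6) (Var 8) (Var 4), gVal (Var 7) (Var 8) (Var 5), gAdd (Var 4) (Var 5) (Var 9)]),
   (gVal (cT (Var 6) (Var 7)) (Var 8) (Var 9), [gVal (Var 6) (Var 8) (Var 4), gVal (Var 7) (Var 8) (Var 5), gMul (Var 4) (Var 5) (Var 9)]),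
   (gVal (cA (Var 6)) (Var 7) (Var 8), [gVal (Var 6) (Var 7) (Var 4), gLook (Var 4) (Var 8) (Var 2) (Var 3)]),
   (gAdd tZ (Var 6) (Var 6), []),
   (gAdd (tS (Var 6)) (Var 7) (tS (Var 8)), [gAdd (Var 6) (Var 7) (Var 8)]),
   (gMul tZ (Var 6) tZ, []),
   (gMul (tS (Var 6)) (Var 7) (Var 8), [gMul (Var 6) (Var 7) (Var 4), gAdd (Var 4) (Var 7) (Var 8)]),
   (gLook (Var 6) (Var 7) (tS (Var 6)) (tCons (Var 7) (Var 8)), []),
   (gLook (Var 6) (Var 7) (tS (Var 8)) (tCons (Var 9) (Var 10)), [gLook (Var 6) (Var 7) (Var 8) (Var 10)]),
   (gNeq tZ (tS (Var 6)), []),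
   (gNeq (tS (Var 6)) tZ, []),
   (gNeq (tS (Var 6)) (tS (Var 7)), [gNeq (Var 6) (Var 7)]),
   (gTru (cEq (Var 6) (Var 7)) (Var 8), [gVal (Var 6) (Var 8) (Var 4), gVal (Var 7) (Var 8) (Var 4)]),
   (gFls (cEq (Var 6) (Var 7)) (Var 8), [gVal (Var 6) (Var 8) (Var 4), gVal (Var 7) (Var 8) (Var 5), gNeq (Var 4) (Var 5)]),
   (gTru (cNeg (Var 6)) (Var 7), [gFls (Var 6) (Var 7)]),
   (gFls (cNeg (Var 6)) (Var 7), [gTru (Var 6) (Var 7)]),
   (gTru (cConj (Var 6) (Var 7)) (Var 8), [gTru (Var 6) (Var 8), gTru (Var 7) (Var 8)]),
   (gFls (cConj (Var 6) (Var 7)) (Var 8), [gFls (Var 6) (Var 8)]),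
   (gFls (cConj (Var 6) (Var 7)) (Var 8), [gFls (Var 7) (Var 8)]),
   (gTru (cEx (Var 6)) (Var 7), [gTru (Var 6) (tCons (Var 4) (Var 7))]),
   (gFls (cEx (Var 6)) (Var 7), [gAll (Var 6) (Var 7) tZ]),
   (gAll (Var 6) (Var 7) (Var 8), [gFls (Var 6) (tCons (Var 8) (Var 7)), gAll (Var 6) (Var 7) (tS (Var 8))])]"

lemma goal_rules_sound:
  assumes "(l, rs) \<in> set goal_rules"
  shows "goal_step (\<sigma> 2) (\<sigma> 3) (\<sigma> 4) (\<sigma> 5) (subst \<sigma> l) (map (subst \<sigma>) rs)"
  using assms unfolding goal_rules_def
  by (simp, elim disjE) (simp_all add: goal_step.intros)

text \<open>\<open>F\<close> and \<open>B\<close> can be prescribed because no goal rule contains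
  variables 0 and 1; the substitution then also instantiates the rule surrounding the goal. It lists
  the six components, then the local variables numbered from 6 on.\<close>

lemma goal_rules_complete:
  assumes "goal_step N L g h G Rs"
  shows "\<exists>\<sigma>. \<sigma> 0 = F \<and> \<sigma> 1 = B \<and> \<sigma> 2 = N \<and> \<sigma> 3 = L \<and> \<sigma> 4 = g \<and> \<sigma> 5 = h \<and>
    (G, Rs) \<in> (\<lambda>(l, rs). (subst \<sigma> l, map (subst \<sigma>) rs)) ` set goal_rules"
  using assms
proof induction
  case (V_0 a b)
  show ?case
    by (rule exI[of _ "(!) [F, B, N, L, g, h, a, b]"]) (simp add: goal_rules_def)
next
  case (V_S i x e v)
  show ?case
    by (rule exI[of _ "(!) [F, B, N, L, g, h, i, x, e, v]"]) (simp add: goal_rules_def)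
next
  case (Zer e)
  show ?case
    by (rule exI[of _ "(!) [F, B, N, L, g, h, e]"]) (simp add: goal_rules_def)
next
  case (Sc t e v)
  show ?case
    by (rule exI[of _ "(!) [F, B, N, L, g, h, t, e, v]"]) (simp add: goal_rules_def)
next
  case (Pl t u e v)
  show ?case
    by (rule exI[of _ "(!) [F, B, N, L, g, h, t, u, e, v]"]) (simp add: goal_rules_def)
next
  case (Tm t u e v)
  show ?case
    by (rule exI[of _ "(!) [F, B, N, L, g, h, t, u, e, v]"]) (simp add: goal_rules_def)
next
  case (Ap t e v)
  show ?case
    by (rule exI[of _ "(!) [F, B, N, L, g, h, t, e, v]"]) (simp add: goal_rules_def)
next
  case (Add_0 y)
  show ?case
    by (rule exI[of _ "(!) [F, B, N, L, g, h, y]"]) (simp add: goal_rules_def)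
next
  case (Add_S x y z)
  show ?case
    by (rule exI[of _ "(!) [F, B, N, L, g, h, x, y, z]"]) (simp add: goal_rules_def)
next
  case (Mul_0 y)
  show ?case
    by (rule exI[of _ "(!) [F, B, N, L, g, h, y]"]) (simp add: goal_rules_def)
next
  case (Mul_S x y z)
  show ?case
    by (rule exI[of _ "(!) [F, B, N, L, g, h, x, y, z]"]) (simp add: goal_rules_def)
next
  case (Look_hit k v M)
  show ?case
    by (rule exI[of _ "(!) [F, B, N, L, g, h, k, v, M]"]) (simp add: goal_rules_def)
next
  case (Look_next k v j x M)
  show ?case
    by (rule exI[of _ "(!) [F, B, N, L, g, h, k, v, j, x, M]"]) (simp add: goal_rules_def)
next
  case (Neq_0S y)
  show ?case
    by (rule exI[of _ "(!) [F, B, N, L, g, h, y]"]) (simp add: goal_rules_def)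
next
  case (Neq_S0 x)
  show ?case
    by (rule exI[of _ "(!) [F, B, N, L, g, h, x]"]) (simp add: goal_rules_def)
next
  case (Neq_SS x y)
  show ?case
    by (rule exI[of _ "(!) [F, B, N, L, g, h, x, y]"]) (simp add: goal_rules_def)
next
  case (Tru_Eq t u e)
  show ?case
    by (rule exI[of _ "(!) [F, B, N, L, g, h, t, u, e]"]) (simp add: goal_rules_def)
next
  case (Fls_Eq t u e)
  show ?case
    by (rule exI[of _ "(!) [F, B, N, L, g, h, t, u, e]"]) (simp add: goal_rules_def)
next
  case (Tru_Neg p e)
  show ?case
    by (rule exI[of _ "(!) [F, B, N, L, g, h, p, e]"]) (simp add: goal_rules_def)
next
  case (Fls_Neg p e)
  show ?case
    by (rule exI[of _ "(!) [F, B, N, L, g, h, p, e]"]) (simp add: goal_rules_def)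
next
  case (Tru_Conj p q e)
  show ?case
    by (rule exI[of _ "(!) [F, B, N, L, g, h, p, q, e]"]) (simp add: goal_rules_def)
next
  case (Fls_Conj1 p q e)
  show ?case
    by (rule exI[of _ "(!) [F, B, N, L, g, h, p, q, e]"]) (simp add: goal_rules_def)
next
  case (Fls_Conj2 p q e)
  show ?case
    by (rule exI[of _ "(!) [F, B, N, L, g, h, p, q, e]"]) (simp add: goal_rules_def)
next
  case (Tru_Ex p e)
  show ?case
    by (rule exI[of _ "(!) [F, B, N, L, g, h, p, e]"]) (simp add: goal_rules_def)
next
  case (Fls_Ex p e)
  show ?case
    by (rule exI[of _ "(!) [F, B, N, L, g, h, p, e]"]) (simp add: goal_rules_def)
next
  case (All p e w)
  show ?case
    by (rule exI[of _ "(!) [F, B, N, L, g, h, p, e, w]"]) (simp add: goal_rules_def)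
qed

fun num :: "nat \<Rightarrow> trm" where
  "num 0 = tZ"
| "num (Suc n) = tS (num n)"

fun code_trm :: "atrm \<Rightarrow> trm" where
  "code_trm (V i) = cV (num i)"
| "code_trm Zer = cZ"
| "code_trm (Sc t) = cS (code_trm t)"
| "code_trm (Pl t u) = cP (code_trm t) (code_trm u)"
| "code_trm (Tm t u) = cT (code_trm t) (code_trm u)"
| "code_trm (Ap t) = cA (code_trm t)"

fun code_fm :: "afm \<Rightarrow> trm" where
  "code_fm (Eq t u) = cEq (code_trm t) (code_trm u)"
| "code_fm (Neg p) = cNeg (code_fm p)"
| "code_fm (Conj p q) = cConj (code_fm p) (code_fm q)"
| "code_fm (Ex p) = cEx (code_fm p)"

abbreviation push :: "trm list \<Rightarrow> trm \<Rightarrow> trm" where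
  "push ts t \<equiv> foldr tCons ts t"

definition env :: "nat list \<Rightarrow> trm" where
  "env e = push (map num e) tNil"

lemma env_simps [simp]: "env [] = tNil" "env (x # e) = tCons (num x) (env e)"
  by (simp_all add: env_def)

lemma num_inject [simp]: "num m = num n \<longleftrightarrow> m = n"
  by (induction m arbitrary: n; case_tac n) auto

text \<open>The first rule starts a new batch and re-inserts the initial goal, so that even a reduction from
  an arbitrary term with infinitely many root steps has to satisfy it. No order is needed inside a
  batch for every goal to be treated eventually.\<close>

definition machine :: "afm \<Rightarrow> nat list \<Rightarrow> trs" where
  "machine \<phi> e =
    (run (ok [tNil, Var 1, Var 2, Var 3, Var 4, Var 5]),
     run (mach [tCons (gFls (code_fm \<phi>) (env e)) (Var 1), tNil, Var 2, Var 3, tZ, tZ])) #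
    map (\<lambda>(l, rs).
      (run (ok [tCons l (Var 0), Var 1, Var 2, Var 3, Var 4, Var 5]),
       run (mach [Var 0, push rs (Var 1), Var 2, Var 3, tZ, tZ]))) goal_rules @
    map (\<lambda>r. (mach [Var 0, Var 1, Var 2, Var 3, Var 4, Var 5], r))
     [wrap (mach [Var 0, Var 1, Var 2, Var 3, tS (Var 4), Var 5]),
      wrap (mach [Var 0, Var 1, Var 2, Var 3, Var 4, tS (Var 5)]),
      wrap (mach [Var 0, Var 1, tS (Var 2), tCons (Var 4) (Var 3), tZ, Var 5]),
      ok [Var 0, Var 1, Var 2, Var 3, Var 4, Var 5]] @
    [(wrap (ok [Var 0, Var 1, Var 2, Var 3, Var 4, Var 5]),
      ok [Var 0, Var 1, Var 2, Var 3, Var 4, Var 5])]"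

text \<open>The last rule commits \<open>g\<close> as the value of \<alpha> at \<open>N\<close>, so
  the memory grows by one consecutive argument at a time.\<close>

inductive guess :: "trm \<times> trm \<times> trm \<times> trm \<Rightarrow> trm \<times> trm \<times> trm \<times> trm \<Rightarrow> bool" where
  "guess (N, L, g, h) (N, L, tS g, h)"
| "guess (N, L, g, h) (N, L, g, tS h)"
| "guess (N, L, g, h) (tS N, tCons g L, tZ, h)"

inductive mstep :: "afm \<Rightarrow> nat list \<Rightarrow> trm \<Rightarrow> trm \<Rightarrow> bool" for \<phi> e where
  guess: "guess (N, L, g, h) (N', L', g', h') \<Longrightarrow>
    mstep \<phi> e (mach [F, B, N, L, g, h]) (wrap (mach [F, B, N', L', g', h']))"
| ok: "mstep \<phi> e (mach [F, B, N, L, g, h]) (ok [F, B, N, L, g, h])"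
| unwrap: "mstep \<phi> e (wrap (ok [F, B, N, L, g, h])) (ok [F, B, N, L, g, h])"
| swap: "mstep \<phi> e (run (ok [tNil, B, N, L, g, h]))
    (run (mach [tCons (gFls (code_fm \<phi>) (env e)) B, tNil, N, L, tZ, tZ]))"
| goal: "goal_step N L g h G Rs \<Longrightarrow> mstep \<phi> e (run (ok [tCons G F, B, N, L, g, h]))
    (run (mach [F, push Rs B, N, L, tZ, tZ]))"

lemma subst_num [simp]: "subst \<sigma> (num n) = num n"
  by (induction n) auto

lemma subst_env [simp]: "subst \<sigma> (env e) = env e"
  by (induction e) auto

lemma subst_code_trm [simp]: "subst \<sigma> (code_trm t) = code_trm t"
  by (induction t) auto

lemma subst_code_fm [simp]: "subst \<sigma> (code_fm p) = code_fm p"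
  by (induction p) auto

lemma subst_push [simp]: "subst \<sigma> (push ts t) = push (map (subst \<sigma>) ts) (subst \<sigma> t)"
  by (induction ts) auto

lemma vars_num [simp]: "vars (num n) = {}"
  by (induction n) auto

lemma vars_env [simp]: "vars (env e) = {}"
  by (induction e) auto

lemma vars_code_trm [simp]: "vars (code_trm t) = {}"
  by (induction t) auto

lemma vars_code_fm [simp]: "vars (code_fm p) = {}"
  by (induction p) auto

lemma vars_push [simp]: "vars (push ts t) = (\<Union>u\<in>set ts. vars u) \<union> vars t"
  by (induction ts) auto

lemma wf_machine: "wf_trs (machine \<phi> e)"
proof -
  have "\<forall>(l, rs) \<in> set goal_rules. \<forall>r \<in> set rs. vars r \<subseteq> vars l \<union> {2, 3, 4, 5}"
    unfolding goal_rules_def by simp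
  then have "\<forall>(l, r) \<in> set (map (\<lambda>(l, rs).
      (run (ok [tCons l (Var 0), Var 1, Var 2, Var 3, Var 4, Var 5]),
       run (mach [Var 0, push rs (Var 1), Var 2, Var 3, tZ, tZ]))) goal_rules).
      (\<exists>f ts. l = Fun f ts) \<and> vars r \<subseteq> vars l"
    by (fastforce simp: subset_eq)
  then show ?thesis
    unfolding wf_trs_def machine_def by (simp add: ball_Un)
qed

lemma root_step_machine: "root_step (machine \<phi> e) s t \<longleftrightarrow> mstep \<phi> e s t"
proof
  assume "root_step (machine \<phi> e) s t"
  then obtain l r \<sigma> where lr: "(l, r) \<in> set (machine \<phi> e)"
    and s: "s = subst \<sigma> l" and t: "t = subst \<sigma> r"
    unfolding root_step_def by auto
  show "mstep \<phi> e s t"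
  proof (cases "\<exists>(l', rs) \<in> set goal_rules.
      l = run (ok [tCons l' (Var 0), Var 1, Var 2, Var 3, Var 4, Var 5]) \<and>
      r = run (mach [Var 0, push rs (Var 1), Var 2, Var 3, tZ, tZ])")
    case True
    then show ?thesis
      using goal_rules_sound by (auto simp: s t intro!: mstep.goal)
  next
    case False
    then show ?thesis
      using lr unfolding machine_def
      by (auto simp: s t intro!: mstep.intros guess.intros)
  qed
next
  have root: "root_step (machine \<phi> e) s t"
    if "(l, r) \<in> set (machine \<phi> e)" "s = subst \<sigma> l" "t = subst \<sigma> r" for l r \<sigma> s t
    using that unfolding root_step_def by blast
  assume "mstep \<phi> e s t"
  then show "root_step (machine \<phi> e) s t"
  proof cases
    case (guess N L g h N' L' g' h' F B)
    let ?\<sigma> = "(!) [F, B, N, L, g, h]"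
    from guess(3) show ?thesis
    proof cases
      case 1
      show ?thesis
        by (rule root[where \<sigma> = ?\<sigma> and l = "mach [Var 0, Var 1, Var 2, Var 3, Var 4, Var 5]"
              and r = "wrap (mach [Var 0, Var 1, Var 2, Var 3, tS (Var 4), Var 5])"])
          (simp_all add: guess 1 machine_def)
    next
      case 2
      show ?thesis
        by (rule root[where \<sigma> = ?\<sigma> and l = "mach [Var 0, Var 1, Var 2, Var 3, Var 4, Var 5]"
              and r = "wrap (mach [Var 0, Var 1, Var 2, Var 3, Var 4, tS (Var 5)])"])
          (simp_all add: guess 2 machine_def)
    next
      case 3
      show ?thesis
        by (rule root[where \<sigma> = ?\<sigma> and l = "mach [Var 0, Var 1, Var 2, Var 3, Var 4, Var 5]"
              and r = "wrap (mach [Var 0, Var 1, tS (Var 2), tCons (Var 4) (Var 3), tZ, Var 5])"])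
          (simp_all add: guess 3 machine_def)
    qed
  next
    case (ok F B N L g h)
    show ?thesis
      by (rule root[where \<sigma> = "(!) [F, B, N, L, g, h]"
            and l = "mach [Var 0, Var 1, Var 2, Var 3, Var 4, Var 5]"
            and r = "ok [Var 0, Var 1, Var 2, Var 3, Var 4, Var 5]"])
        (simp_all add: ok machine_def)
  next
    case (unwrap F B N L g h)
    show ?thesis
      by (rule root[where \<sigma> = "(!) [F, B, N, L, g, h]"
            and l = "wrap (ok [Var 0, Var 1, Var 2, Var 3, Var 4, Var 5])"
            and r = "ok [Var 0, Var 1, Var 2, Var 3, Var 4, Var 5]"])
        (simp_all add: unwrap machine_def)
  next
    case (swap B N L g h)
    show ?thesis
      by (rule root[where \<sigma> = "(!) [tNil, B, N, L, g, h]"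
            and l = "run (ok [tNil, Var 1, Var 2, Var 3, Var 4, Var 5])"
            and r = "run (mach [tCons (gFls (code_fm \<phi>) (env e)) (Var 1), tNil, Var 2, Var 3, tZ, tZ])"])
        (simp_all add: swap machine_def)
  next
    case (goal N L g h G Rs F B)
    obtain \<sigma> l rs where \<sigma>: "\<sigma> 0 = F \<and> \<sigma> 1 = B \<and> \<sigma> 2 = N \<and> \<sigma> 3 = L \<and> \<sigma> 4 = g \<and> \<sigma> 5 = h"
      and lrs: "(l, rs) \<in> set goal_rules" "G = subst \<sigma> l" "Rs = map (subst \<sigma>) rs"
      using goal_rules_complete[OF goal(3)] by fastforce
    have mem: "(run (ok [tCons l (Var 0), Var 1, Var 2, Var 3, Var 4, Var 5]),
        run (mach [Var 0, push rs (Var 1), Var 2, Var 3, tZ, tZ])) \<in> set (machine \<phi> e)"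
      using lrs(1) unfolding machine_def by (auto intro!: rev_image_eqI)
    show ?thesis
      using \<sigma> by (intro root[OF mem, of _ \<sigma>]) (simp_all only: goal lrs, simp_all)
  qed
qed

section \<open>Reductions of the rewrite system\<close>

type_synonym conf = "trm \<times> trm \<times> trm \<times> trm"

text \<open>A root step at \<open>run\<close> with the guessing before it. Guesses restart from
  \<open>tZ\<close> after each such step, so they are genuine numerals whatever term the reduction
  began with, and need no place in \<open>conf\<close>.\<close>

inductive round :: "afm \<Rightarrow> nat list \<Rightarrow> conf \<Rightarrow> conf \<Rightarrow> bool" for \<phi> e where
  swap: "guess\<^sup>*\<^sup>* (N, L, tZ, tZ) (N', L', g, h) \<Longrightarrow>
    round \<phi> e (tNil, B, N, L) (tCons (gFls (code_fm \<phi>) (env e)) B, tNil, N', L')"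
| goal: "guess\<^sup>*\<^sup>* (N, L, tZ, tZ) (N', L', g, h) \<Longrightarrow> goal_step N' L' g h G Rs \<Longrightarrow>
    round \<phi> e (tCons G F, B, N, L) (F, push Rs B, N', L')"

fun start :: "conf \<Rightarrow> trm" where
  "start (F, B, N, L) = run (mach [F, B, N, L, tZ, tZ])"

lemma rstep_run: "(rstep R)\<^sup>*\<^sup>* s t \<Longrightarrow> (rstep R)\<^sup>*\<^sup>* (Fun f [s]) (Fun f [t])"
proof (induction rule: rtranclp_induct)
  case (step t u)
  then show ?case
    using rstep.ctxt[of R t u f "[]" "[]"] by auto
qed simp

text \<open>Guesses pile up \<open>wrap\<close>s, which vanish only after the innermost term has
  become \<open>ok\<close>. Induction from the front matches this nesting: all later guessing
  happens below the outermost \<open>wrap\<close>.\<close>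

lemma guess_rsteps:
  assumes "guess\<^sup>*\<^sup>* x (N', L', g', h')"
  shows "(\<lambda>(N, L, g, h). (rstep (machine \<phi> e))\<^sup>*\<^sup>* (mach [F, B, N, L, g, h])
    (ok [F, B, N', L', g', h'])) x"
  using assms
proof (induction rule: converse_rtranclp_induct)
  case base
  show ?case
    by (auto intro!: r_into_rtranclp rstep.root mstep.ok simp: root_step_machine)
next
  case (step y z)
  obtain N L g h where y: "y = (N, L, g, h)" by (cases y)
  obtain N1 L1 g1 h1 where z: "z = (N1, L1, g1, h1)" by (cases z)
  let ?S = "rstep (machine \<phi> e)"
  have "?S (mach [F, B, N, L, g, h]) (wrap (mach [F, B, N1, L1, g1, h1]))"
    using step(1) by (auto intro!: rstep.root mstep.guess simp: root_step_machine y z)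
  also have "?S\<^sup>*\<^sup>* (wrap (mach [F, B, N1, L1, g1, h1])) (wrap (ok [F, B, N', L', g', h']))"
    using step(3) by (auto simp: z intro: rstep_run)
  also have "?S (wrap (ok [F, B, N', L', g', h'])) (ok [F, B, N', L', g', h'])"
    by (auto intro!: rstep.root mstep.unwrap simp: root_step_machine)
  finally show ?case by (simp add: y)
qed

lemma round_imp_steps:
  assumes "round \<phi> e C C'"
  shows "((rstep (machine \<phi> e))\<^sup>*\<^sup>* OO root_step (machine \<phi> e)) (start C) (start C')"
  using assms
proof cases
  case (swap N L N' L' g h B)
  have "mstep \<phi> e (run (ok [tNil, B, N', L', g, h])) (start C')"
    by (auto simp: swap intro: mstep.swap)
  then show ?thesis
    using rstep_run[OF guess_rsteps[OF swap(3), simplified], of \<phi> e 6 tNil B]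
    by (auto simp: root_step_machine swap intro: relcomppI)
next
  case (goal N L N' L' g h G Rs F B)
  have "mstep \<phi> e (run (ok [tCons G F, B, N', L', g, h])) (start C')"
    using goal by (auto intro: mstep.goal)
  then show ?thesis
    using rstep_run[OF guess_rsteps[OF goal(3), simplified], of \<phi> e 6 "tCons G F" B]
    by (auto simp: root_step_machine goal intro: relcomppI)
qed

text \<open>A subterm whose root is one of the four machine symbols keeps such a root under rewriting, hence it
  is never inspected by the machine when it occurs as data. Identifying all of them turns
  inner steps into equalities.\<close>

fun collapse :: "trm \<Rightarrow> trm" where
  "collapse (Var x) = Var x"
| "collapse (Fun f ts) = (if f \<in> {4, 5, 6, 7} then Var 0 else Fun f (map collapse ts))"

lemma collapse_num [simp]: "collapse (num n) = num n"
  by (induction n) auto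

lemma collapse_env [simp]: "collapse (env e) = env e"
  by (induction e) auto

lemma collapse_code_trm [simp]: "collapse (code_trm t) = code_trm t"
  by (induction t) auto

lemma collapse_code_fm [simp]: "collapse (code_fm p) = code_fm p"
  by (induction p) auto

lemma collapse_push [simp]: "collapse (push ts t) = push (map collapse ts) (collapse t)"
  by (induction ts) auto

text \<open>Goal patterns contain no machine symbol, and repeated variables still match because
  equal terms collapse to equal terms.\<close>

lemma goal_step_collapse:
  "goal_step N L g h G Rs \<Longrightarrow>
    goal_step (collapse N) (collapse L) (collapse g) (collapse h) (collapse G) (map collapse Rs)"
  by (induction rule: goal_step.induct) (simp_all add: goal_step.intros)

lemma guess_collapse:
  "guess (N, L, g, h) (N', L', g', h') \<Longrightarrow>
    guess (collapse N, collapse L, collapse g, collapse h)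
      (collapse N', collapse L', collapse g', collapse h')"
  by (auto elim!: guess.cases intro!: guess.intros)

lemma rstep_collapse:
  "rstep (machine \<phi> e) s t \<Longrightarrow> collapse s = collapse t"
  by (induction rule: rstep.induct) (auto simp: root_step_machine elim: mstep.cases)

inductive cfg :: "trm \<Rightarrow> trm list \<Rightarrow> bool" where
  mach: "cfg (mach ts) (map collapse ts)"
| ok: "cfg (ok ts) (map collapse ts)"
| wrap: "cfg t xs \<Longrightarrow> cfg (wrap t) xs"

lemma cfg_okD: "cfg (ok ts) xs \<Longrightarrow> xs = map collapse ts"
  by (auto elim: cfg.cases)

lemma rstep_argE:
  assumes "rstep R (Fun f ts) t" "\<not> root_step R (Fun f ts) t"
  obtains ss1 s s' ss2 where "ts = ss1 @ s # ss2" "t = Fun f (ss1 @ s' # ss2)" "rstep R s s'"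
  using assms by (cases rule: rstep.cases) auto

text \<open>A step inside an argument is invisible after \<open>collapse\<close>, and turning
  \<open>mach\<close> into \<open>ok\<close> or removing a \<open>wrap\<close> keeps the arguments;
  only guesses remain.\<close>

lemma cfg_rstep:
  assumes "cfg t [F, B, N, L, g, h]" "rstep (machine \<phi> e) t t'"
  shows "\<exists>N' L' g' h'. cfg t' [F, B, N', L', g', h'] \<and> guess\<^sup>*\<^sup>* (N, L, g, h) (N', L', g', h')"
  using assms
proof (induction t "[F, B, N, L, g, h]" arbitrary: t' rule: cfg.induct)
  case (mach ts)
  show ?case
  proof (cases "root_step (machine \<phi> e) (mach ts) t'")
    case True
    then have "mstep \<phi> e (mach ts) t'"
      by (simp add: root_step_machine)
    then show ?thesis
    proof cases
      case (guess N1 L1 g1 h1 N' L' g' h' F1 B1)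
      then have "cfg t' [F, B, collapse N', collapse L', collapse g', collapse h']"
        using mach(1) cfg.wrap[OF cfg.mach[of "[F1, B1, N', L', g', h']"]] by auto
      moreover have "guess (N, L, g, h) (collapse N', collapse L', collapse g', collapse h')"
        using guess mach(1) guess_collapse[OF guess(3)] by auto
      ultimately show ?thesis by blast
    next
      case ok
      then show ?thesis using mach(1) cfg.ok[of ts] by auto
    qed auto
  next
    case False
    then obtain ss1 s s' ss2 where "ts = ss1 @ s # ss2" "t' = mach (ss1 @ s' # ss2)"
      "rstep (machine \<phi> e) s s'"
      using mach(2) by (auto elim: rstep_argE)
    then show ?thesis
      using mach(1) cfg.mach[of "ss1 @ s' # ss2"] rstep_collapse[of \<phi> e s s'] by auto
  qed
next
  case (ok ts)
  have "\<not> root_step (machine \<phi> e) (ok ts) t'"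
    by (auto simp: root_step_machine elim: mstep.cases)
  then obtain ss1 s s' ss2 where "ts = ss1 @ s # ss2" "t' = ok (ss1 @ s' # ss2)"
    "rstep (machine \<phi> e) s s'"
    using ok(2) by (auto elim: rstep_argE)
  then show ?case
    using ok(1) cfg.ok[of "ss1 @ s' # ss2"] rstep_collapse[of \<phi> e s s'] by auto
next
  case (wrap t)
  show ?case
  proof (cases "root_step (machine \<phi> e) (wrap t) t'")
    case True
    then have "t' = t"
      by (auto simp: root_step_machine elim: mstep.cases)
    then show ?thesis using wrap(1) by auto
  next
    case False
    then obtain s' where "t' = wrap s'" "rstep (machine \<phi> e) t s'"
      using wrap(3) by (auto elim!: rstep_argE simp: Cons_eq_append_conv)
    then show ?thesis
      using wrap(2) cfg.wrap by blast
  qed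
qed

text \<open>The configuration is the one right after the last root step; guesses made since then
  stay pending and are charged to the next round.\<close>

inductive running :: "conf \<Rightarrow> trm \<Rightarrow> bool" where
  "cfg t [F, B, N', L', g, h] \<Longrightarrow> guess\<^sup>*\<^sup>* (N, L, tZ, tZ) (N', L', g, h) \<Longrightarrow>
    running (F, B, N, L) (run t)"

lemma running_mach:
  "running (collapse F, collapse B, collapse N, collapse L) (run (mach [F, B, N, L, tZ, tZ]))"
  using cfg.mach[of "[F, B, N, L, tZ, tZ]"] by (auto intro!: running.intros)

lemma running_root_step:
  assumes "running C s" "root_step (machine \<phi> e) s t"
  shows "\<exists>C'. running C' t \<and> round \<phi> e C C'"
  using assms(1)
proof cases
  case (1 u F B N' L' g h N L)
  have "mstep \<phi> e (run u) t"
    using assms(2) by (simp add: root_step_machine 1)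
  then show ?thesis
  proof cases
    case (swap B1 N1 L1 g1 h1)
    let ?C = "(tCons (gFls (code_fm \<phi>) (env e)) (collapse B1), tNil, collapse N1, collapse L1)"
    have "running ?C t"
      using running_mach[of "tCons (gFls (code_fm \<phi>) (env e)) B1" tNil N1 L1] swap by simp
    moreover have "round \<phi> e C ?C"
      using 1 swap by (auto dest!: cfg_okD intro: round.swap)
    ultimately show ?thesis by blast
  next
    case (goal N1 L1 g1 h1 G Rs F1 B1)
    let ?C = "(collapse F1, push (map collapse Rs) (collapse B1), collapse N1, collapse L1)"
    have "running ?C t"
      using running_mach[of F1 "push Rs B1" N1 L1] goal by simp
    moreover have "round \<phi> e C ?C"
      using 1 goal goal_step_collapse[OF goal(3)] by (auto dest!: cfg_okD intro: round.goal)
    ultimately show ?thesis by blast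
  qed auto
qed

text \<open>\<open>rstep\<close> includes steps at the root, and such a step already performs a
  round; all others perform none.\<close>

lemma running_rstep:
  assumes "running C s" "rstep (machine \<phi> e) s t"
  shows "\<exists>C'. running C' t \<and> (round \<phi> e)\<^sup>*\<^sup>* C C'"
proof (cases "root_step (machine \<phi> e) s t")
  case True
  then show ?thesis
    using running_root_step[OF assms(1)] by blast
next
  case False
  from assms(1) show ?thesis
  proof cases
    case (1 u F B N' L' g h N L)
    then obtain u' where t: "t = run u'" "rstep (machine \<phi> e) u u'"
      using assms(2) False by (auto elim!: rstep_argE simp: Cons_eq_append_conv)
    obtain N'' L'' g'' h'' where "cfg u' [F, B, N'', L'', g'', h'']"
      "guess\<^sup>*\<^sup>* (N', L', g, h) (N'', L'', g'', h'')"
      using cfg_rstep[OF 1(3) t(2)] by blast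
    then have "running C t"
      using 1 t(1) by (auto intro!: running.intros elim: rtranclp_trans)
    then show ?thesis by blast
  qed
qed

lemma running_rsteps:
  assumes "(rstep (machine \<phi> e))\<^sup>*\<^sup>* s t" "running C s"
  shows "\<exists>C'. running C' t \<and> (round \<phi> e)\<^sup>*\<^sup>* C C'"
  using assms
proof (induction rule: rtranclp_induct)
  case (step t u)
  then show ?case
    using running_rstep by (meson rtranclp_trans)
qed (use assms in blast)

section \<open>Root steps at terms not headed by \<open>run\<close>\<close>

fun root_sym :: "trm \<Rightarrow> nat" where
  "root_sym (Var x) = 0"
| "root_sym (Fun f ts) = f"

text \<open>Bounds the root steps still possible away from \<open>run\<close>: \<open>mach\<close>
  can become \<open>wrap\<close> or \<open>ok\<close>, \<open>wrap\<close> can become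
  \<open>ok\<close>, and nothing follows.\<close>

definition rank :: "trm \<Rightarrow> nat" where
  "rank t = (if root_sym t = 4 then 2 else if root_sym t = 5 then 1 else 0)"

lemma rank_root_step:
  assumes "root_step (machine \<phi> e) s t" "root_sym s \<noteq> 6"
  shows "root_sym t \<noteq> 6 \<and> rank t < rank s"
  using assms by (auto simp: root_step_machine rank_def elim: mstep.cases)

lemma rstep_sym: "rstep R s t \<Longrightarrow> root_step R s t \<or> root_sym s = root_sym t"
  by (auto elim: rstep.cases)

lemma rank_rsteps:
  assumes "(rstep (machine \<phi> e))\<^sup>*\<^sup>* s t" "root_sym s \<noteq> 6"
  shows "root_sym t \<noteq> 6 \<and> rank t \<le> rank s"
  using assms
proof (induction rule: rtranclp_induct)
  case (step t u)
  from rstep_sym[OF step(2)] have "root_sym u \<noteq> 6 \<and> rank u \<le> rank t"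
    using step rank_root_step[of \<phi> e t u] by (elim disjE) (simp_all add: rank_def)
  then show ?case using step by auto
qed auto

lemma sym_run_rsteps:
  assumes "(rstep (machine \<phi> e))\<^sup>*\<^sup>* s t" "root_sym s = 6"
  shows "root_sym t = 6"
  using assms
proof (induction rule: rtranclp_induct)
  case (step t u)
  then show ?case
    using rstep_sym[OF step(2)] by (auto simp: root_step_machine elim: mstep.cases)
qed auto

lemma not_SN_imp_rounds:
  assumes "\<not> SN_rel_on (machine \<phi> e) (machine \<phi> e) t"
  shows "\<exists>C. \<forall>i :: nat. round \<phi> e (C i) (C (Suc i))"
proof -
  let ?M = "machine \<phi> e"
  obtain f where f: "\<And>i :: nat. ((rstep ?M)\<^sup>*\<^sup>* OO root_step ?M) (f i) (f (Suc i))"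
    using assms unfolding SN_rel_on_def by blast
  \<comment> \<open>Otherwise each root step lowers \<open>rank\<close>, which allows only finitely
    many.\<close>
  have "root_sym (f 0) = 6"
  proof (rule ccontr)
    assume "root_sym (f 0) \<noteq> 6"
    then have "root_sym (f i) \<noteq> 6 \<and> rank (f i) + i \<le> rank (f 0)" for i
    proof (induction i)
      case (Suc i)
      obtain u where "(rstep ?M)\<^sup>*\<^sup>* (f i) u" "root_step ?M u (f (Suc i))"
        using f by blast
      then show ?case
        using Suc rank_rsteps[of \<phi> e "f i" u] rank_root_step[of \<phi> e u "f (Suc i)"] by auto
    qed auto
    then show False
      by (metis add_leE not_less_eq_eq)
  qed
  then obtain u where "root_step ?M u (f 1)" "root_sym u = 6"
    using f[of 0] sym_run_rsteps by fastforce
  \<comment> \<open>The first root step resets the guesses of any \<open>run\<close> term, so the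
    simulation starts at index 1.\<close>
  then have "\<exists>F B N L. f (Suc 0) = run (mach [F, B, N, L, tZ, tZ])"
    by (auto simp: root_step_machine elim!: mstep.cases)
  then have "\<exists>C. running C (f (Suc 0))"
    using running_mach by metis
  moreover have "\<exists>C'. running C' (f (Suc (Suc i))) \<and> (round \<phi> e)\<^sup>+\<^sup>+ C C'"
    if "running C (f (Suc i))" for C i
  proof -
    obtain u where "(rstep ?M)\<^sup>*\<^sup>* (f (Suc i)) u" "root_step ?M u (f (Suc (Suc i)))"
      using f by blast
    then show ?thesis
      using running_rsteps[OF _ that] running_root_step by (meson rtranclp_into_tranclp1)
  qed
  ultimately obtain C where "\<And>i. (round \<phi> e)\<^sup>+\<^sup>+ (C i) (C (Suc i))"
    using dependent_nat_choice[of "\<lambda>i C. running C (f (Suc i))" "\<lambda>i. (round \<phi> e)\<^sup>+\<^sup>+"] by metis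
  \<comment> \<open>Several rounds may lie between consecutive terms; since well-foundedness passes
    to the transitive closure, single rounds form an infinite chain as well.\<close>
  then have "\<not> wf ({(y, x). round \<phi> e x y}\<^sup>+)"
    unfolding wf_iff_no_infinite_down_chain
    using trancl_converse[of "{(x, y). round \<phi> e x y}"]
    by (auto simp: tranclp_unfold converse_unfold)
  then have "\<not> wf {(y, x). round \<phi> e x y}"
    using wf_trancl by blast
  then show ?thesis
    unfolding wf_iff_no_infinite_down_chain by blast
qed

lemma rounds_imp_not_SN:
  assumes "\<And>i :: nat. round \<phi> e (C i) (C (Suc i))"
  shows "\<not> SN_rel_on (machine \<phi> e) (machine \<phi> e) (start (C 0))"
  unfolding SN_rel_on_def using round_imp_steps[OF assms] by (auto intro!: exI[of _ "\<lambda>i. start (C i)"])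

section \<open>Infinite runs and falsifying functions\<close>

inductive entry :: "trm \<Rightarrow> trm \<Rightarrow> trm \<Rightarrow> trm \<Rightarrow> bool" for k v where
  hit: "entry k v (tS k) (tCons v M)"
| skip: "entry k v j M \<Longrightarrow> entry k v (tS j) (tCons x M)"

lemma entry_size: "entry k v N L \<Longrightarrow> size k < size N"
  by (induction rule: entry.induct) auto

text \<open>A hit at length \<open>tS k\<close> excludes one further down, which would need
  \<open>size k < size k\<close>. Sizes are compared because lengths and positions may be arbitrary
  terms.\<close>

lemma entry_unique:
  "entry k v N L \<Longrightarrow> entry k v' N L \<Longrightarrow> v = v'"
proof (induction rule: entry.induct)
  case (hit M)
  from hit show ?case by cases (auto dest: entry_size)
next
  case (skip j M x)
  from skip(3) show ?case
    using skip(1,2) by cases (auto dest: entry_size)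
qed

text \<open>Each commit lengthens \<open>L\<close> and \<open>N\<close> together, so entries,
  located from the far end, persist.\<close>

lemma guesses_invariant:
  assumes "guess\<^sup>*\<^sup>* (N, L, tZ, tZ) y"
  shows "\<exists>N' L' a b. y = (N', L', num a, num b) \<and> (\<forall>k v. entry k v N L \<longrightarrow> entry k v N' L')"
  using assms
proof (induction rule: rtranclp_induct)
  case base
  have "tZ = num 0" by simp
  then show ?case by blast
next
  case (step y z)
  then obtain N' L' a b where y: "y = (N', L', num a, num b)"
    and E: "\<And>k v. entry k v N L \<Longrightarrow> entry k v N' L'"
    by blast
  have *: "tZ = num 0" "tS (num n) = num (Suc n)" for n
    by simp_all
  from step(2)[unfolded y] show ?case
    by cases (use E entry.skip in \<open>blast intro: *\<close>)+
qed

text \<open>Queues stem from an arbitrary starting term, so membership is defined for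
  \<open>tCons\<close> chains with any tail.\<close>

inductive elem :: "trm \<Rightarrow> trm \<Rightarrow> bool" for G where
  "elem G (tCons G l)"
| "elem G l \<Longrightarrow> elem G (tCons x l)"

lemma elem_tCons: "elem G (tCons x l) \<longleftrightarrow> G = x \<or> elem G l"
  by (auto intro: elem.intros elim: elem.cases)

lemma elem_push: "elem G (push Rs l) \<longleftrightarrow> G \<in> set Rs \<or> elem G l"
  by (induction Rs) (auto simp: elem_tCons)

locale round_sequence =
  fixes \<phi> :: afm and e\<^sub>0 :: "nat list" and F B N L :: "nat \<Rightarrow> trm"
  assumes round: "round \<phi> e\<^sub>0 (F i, B i, N i, L i) (F (Suc i), B (Suc i), N (Suc i), L (Suc i))"
begin

lemma round_cases:
  obtains (swap) "F i = tNil" "F (Suc i) = tCons (gFls (code_fm \<phi>) (env e\<^sub>0)) (B i)"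
  | (goal) G Rs a b where "F i = tCons G (F (Suc i))" "B (Suc i) = push Rs (B i)"
      "goal_step (N (Suc i)) (L (Suc i)) (num a) (num b) G Rs"
  using round[of i]
proof cases
  case swap
  then show ?thesis using that(1) by blast
next
  case (goal g h G Rs)
  then show ?thesis using guesses_invariant[OF goal(3)] that(2) by auto
qed

lemma entry_mono: "i \<le> j \<Longrightarrow> entry k v (N i) (L i) \<Longrightarrow> entry k v (N j) (L j)"
proof (induction j rule: dec_induct)
  case (step j)
  from round[of j] show ?case
    using step by cases (use guesses_invariant in blast)+
qed

definition occ :: "trm \<Rightarrow> bool" where
  "occ G \<longleftrightarrow> (\<exists>i. elem G (F i) \<or> elem G (B i))"

text \<open>A swap needs an empty front queue, so a goal in it cannot be lost and in time reaches
  the head.\<close>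

lemma front_processed:
  "elem G l \<Longrightarrow> l = F i \<Longrightarrow>
    \<exists>j a b Rs. goal_step (N j) (L j) (num a) (num b) G Rs \<and> (\<forall>R \<in> set Rs. occ R)"
proof (induction arbitrary: i rule: elem.induct)
  case (1 l)
  show ?case
  proof (cases i rule: round_cases)
    case swap
    then show ?thesis using 1 by simp
  next
    case (goal G' Rs a b)
    have "occ R" if "R \<in> set Rs" for R
      using that goal(2) elem_push unfolding occ_def by metis
    moreover have "G' = G" using goal(1) 1 by simp
    ultimately show ?thesis using goal(3) by blast
  qed
next
  case (2 l x)
  show ?case
    by (cases i rule: round_cases) (use 2 in auto)
qed

text \<open>New goals go to the back only, so the front queue shrinks with every treated goal until
  a swap moves the back queue to the front.\<close>

lemma back_reaches_front: "elem G (B i) \<Longrightarrow> \<exists>j. elem G (F j)"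
proof (induction "size (F i)" arbitrary: i rule: less_induct)
  case less
  show ?case
  proof (cases i rule: round_cases)
    case swap
    then show ?thesis using less(2) elem_tCons by metis
  next
    case (goal G' Rs a b)
    then show ?thesis using less(1)[of "Suc i"] less(2) by (simp add: elem_push)
  qed
qed

lemma occ_processed:
  assumes "occ G"
  shows "\<exists>j a b Rs. goal_step (N j) (L j) (num a) (num b) G Rs \<and> (\<forall>R \<in> set Rs. occ R)"
  using assms front_processed back_reaches_front unfolding occ_def by metis

lemma swap_happens: "\<exists>j \<ge> i. F j = tNil"
proof (induction "size (F i)" arbitrary: i rule: less_induct)
  case less
  show ?case
    proof (cases i rule: round_cases)
    case swap
    then show ?thesis by blast
  next
    case goal
    then show ?thesis using less[of "Suc i"] Suc_leD by fastforce
  qed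
qed

lemma occ_start: "occ (gFls (code_fm \<phi>) (env e\<^sub>0))"
proof -
  obtain j where "F j = tNil"
    using swap_happens by blast
  then have "F (Suc j) = tCons (gFls (code_fm \<phi>) (env e\<^sub>0)) (B j)"
    by (cases j rule: round_cases) auto
  then show ?thesis
    unfolding occ_def by (metis elem.intros(1))
qed

text \<open>Where no numeral is ever recorded the value is arbitrary; this is harmless, since every
  lookup goal that occurs has an entry by \<open>occ_Look\<close>.\<close>

definition limit_fun :: "nat \<Rightarrow> nat" where
  "limit_fun k = (SOME v. \<exists>i. entry (num k) (num v) (N i) (L i))"

lemma limit_fun_eq:
  assumes "entry (num k) (num v) (N i) (L i)"
  shows "limit_fun k = v"
  unfolding limit_fun_def
proof (rule some_equality)
  show "\<exists>i. entry (num k) (num v) (N i) (L i)"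
    using assms by blast
  fix w assume "\<exists>i. entry (num k) (num w) (N i) (L i)"
  then obtain j where "entry (num k) (num w) (N j) (L j)" by blast
  then have "num w = num v"
    using assms entry_mono[of i "max i j"] entry_mono[of j "max i j"] entry_unique by (metis max.cobounded1 max.cobounded2)
  then show "w = v" by simp
qed

text \<open>The pattern for the goals below: a goal that occurs is treated by some rule, whose
  subgoals occur too and are simpler, so the induction hypothesis applies to them.\<close>

lemma occ_Add: "occ (gAdd (num x) (num y) (num z)) \<Longrightarrow> x + y = z"
proof (induction x arbitrary: z)
  case 0
  obtain j a b Rs
    where step: "goal_step (N j) (L j) (num a) (num b) (gAdd (num 0) (num y) (num z)) Rs"
    and Rs: "\<forall>R \<in> set Rs. occ R"
    using occ_processed[OF 0] by blast
  from step show ?case using Rs by cases auto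
next
  case (Suc x)
  obtain j a b Rs
    where step: "goal_step (N j) (L j) (num a) (num b) (gAdd (num (Suc x)) (num y) (num z)) Rs"
    and Rs: "\<forall>R \<in> set Rs. occ R"
    using occ_processed[OF Suc(2)] by blast
  from step show ?case
    using Rs Suc(1) by cases (cases z; auto)+
qed

lemma occ_Mul: "occ (gMul (num x) (num y) (num z)) \<Longrightarrow> x * y = z"
proof (induction x arbitrary: z)
  case 0
  obtain j a b Rs
    where step: "goal_step (N j) (L j) (num a) (num b) (gMul (num 0) (num y) (num z)) Rs"
    and Rs: "\<forall>R \<in> set Rs. occ R"
    using occ_processed[OF 0] by blast
  from step show ?case by cases (cases z; auto)+
next
  case (Suc x)
  obtain j a b Rs
    where step: "goal_step (N j) (L j) (num a) (num b) (gMul (num (Suc x)) (num y) (num z)) Rs"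
    and Rs: "\<forall>R \<in> set Rs. occ R"
    using occ_processed[OF Suc(2)] by blast
  from step show ?case
    using Rs Suc(1)[of a] occ_Add[of a y z] by cases auto
qed

lemma occ_Neq: "occ (gNeq (num x) (num y)) \<Longrightarrow> x \<noteq> y"
proof (induction x arbitrary: y)
  case 0
  obtain j a b Rs
    where step: "goal_step (N j) (L j) (num a) (num b) (gNeq (num 0) (num y)) Rs"
    and Rs: "\<forall>R \<in> set Rs. occ R"
    using occ_processed[OF 0] by blast
  from step show ?case using Rs by cases (cases y; auto)+
next
  case (Suc x)
  obtain j a b Rs
    where step: "goal_step (N j) (L j) (num a) (num b) (gNeq (num (Suc x)) (num y)) Rs"
    and Rs: "\<forall>R \<in> set Rs. occ R"
    using occ_processed[OF Suc(2)] by blast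
  from step show ?case
    using Rs Suc(1) by cases (cases y; auto)+
qed

lemma occ_Look: "occ (gLook k v M D) \<Longrightarrow> entry k v M D"
proof (induction "size D" arbitrary: M D rule: less_induct)
  case less
  obtain j a b Rs
    where step: "goal_step (N j) (L j) (num a) (num b) (gLook k v M D) Rs"
    and Rs: "\<forall>R \<in> set Rs. occ R"
    using occ_processed[OF less(2)] by blast
  from step show ?case
    using Rs less(1) by cases (auto intro: entry.intros)
qed

text \<open>In the empty environment no rule matches, so an index out of range never occurs in a
  treated goal. Conversely such an index blocks the machine, which is why completeness requires
  \<open>bound_trm\<close>.\<close>

lemma occ_V: "occ (gVal (cV (num i)) (env e) (num v)) \<Longrightarrow> e ! i = v"
proof (induction e arbitrary: i)
  case Nil
  obtain j a b Rs
    where step: "goal_step (N j) (L j) (num a) (num b) (gVal (cV (num i)) (env []) (num v)) Rs"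
    and Rs: "\<forall>R \<in> set Rs. occ R"
    using occ_processed[OF Nil] by blast
  from step show ?case using Rs by cases auto
next
  case (Cons x e)
  obtain j a b Rs
    where step: "goal_step (N j) (L j) (num a) (num b) (gVal (cV (num i)) (env (x # e)) (num v)) Rs"
    and Rs: "\<forall>R \<in> set Rs. occ R"
    using occ_processed[OF Cons(2)] by blast
  from step show ?case
    using Rs Cons(1) by cases (cases i; auto)+
qed

lemma occ_Val: "occ (gVal (code_trm t) (env e) (num v)) \<Longrightarrow> aval limit_fun e t = v"
proof (induction t arbitrary: v)
  case (V i)
  then show ?case using occ_V by simp
next
  case Zer
  obtain j a b Rs
    where step: "goal_step (N j) (L j) (num a) (num b) (gVal (code_trm Zer) (env e) (num v)) Rs"
    and Rs: "\<forall>R \<in> set Rs. occ R"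
    using occ_processed[OF Zer] by blast
  from step show ?case by cases (cases v; auto)+
next
  case (Sc t)
  obtain j a b Rs
    where step: "goal_step (N j) (L j) (num a) (num b) (gVal (code_trm (Sc t)) (env e) (num v)) Rs"
    and Rs: "\<forall>R \<in> set Rs. occ R"
    using occ_processed[OF Sc(2)] by blast
  from step show ?case
    using Rs Sc(1) by cases (cases v; auto)+
next
  case (Pl t u)
  obtain j a b Rs
    where step: "goal_step (N j) (L j) (num a) (num b) (gVal (code_trm (Pl t u)) (env e) (num v)) Rs"
    and Rs: "\<forall>R \<in> set Rs. occ R"
    using occ_processed[OF Pl(3)] by blast
  from step show ?case
    using Rs Pl(1)[of a] Pl(2)[of b] occ_Add[of a b v] by cases auto
next
  case (Tm t u)
  obtain j a b Rs
    where step: "goal_step (N j) (L j) (num a) (num b) (gVal (code_trm (Tm t u)) (env e) (num v)) Rs"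
    and Rs: "\<forall>R \<in> set Rs. occ R"
    using occ_processed[OF Tm(3)] by blast
  from step show ?case
    using Rs Tm(1)[of a] Tm(2)[of b] occ_Mul[of a b v] by cases auto
next
  case (Ap t)
  obtain j a b Rs
    where step: "goal_step (N j) (L j) (num a) (num b) (gVal (code_trm (Ap t)) (env e) (num v)) Rs"
    and Rs: "\<forall>R \<in> set Rs. occ R"
    using occ_processed[OF Ap(2)] by blast
  from step show ?case
    using Rs Ap(1)[of a] limit_fun_eq[of a v j] occ_Look[of "num a" "num v" "N j" "L j"] by cases auto
qed

text \<open>Both polarities are proved at once, as negation exchanges them.\<close>

lemma occ_fm:
  "(occ (gTru (code_fm p) (env e)) \<longrightarrow> asat limit_fun e p) \<and>
   (occ (gFls (code_fm p) (env e)) \<longrightarrow> \<not> asat limit_fun e p)"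
proof (induction p arbitrary: e)
  case (Eq t u)
  have "asat limit_fun e (Eq t u)" if T: "occ (gTru (code_fm (Eq t u)) (env e))"
  proof -
    obtain j a b Rs
      where step: "goal_step (N j) (L j) (num a) (num b) (gTru (code_fm (Eq t u)) (env e)) Rs"
      and Rs: "\<forall>R \<in> set Rs. occ R"
      using occ_processed[OF T] by blast
    from step show ?thesis
      using Rs occ_Val[of t e a] occ_Val[of u e a] by cases auto
  qed
  moreover have "\<not> asat limit_fun e (Eq t u)" if T: "occ (gFls (code_fm (Eq t u)) (env e))"
  proof -
    obtain j a b Rs
      where step: "goal_step (N j) (L j) (num a) (num b) (gFls (code_fm (Eq t u)) (env e)) Rs"
      and Rs: "\<forall>R \<in> set Rs. occ R"
      using occ_processed[OF T] by blast
    from step show ?thesis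
      using Rs occ_Val[of t e a] occ_Val[of u e b] occ_Neq[of a b] by cases auto
  qed
  ultimately show ?case by blast
next
  case (Neg p)
  have "asat limit_fun e (Neg p)" if T: "occ (gTru (code_fm (Neg p)) (env e))"
  proof -
    obtain j a b Rs
      where step: "goal_step (N j) (L j) (num a) (num b) (gTru (code_fm (Neg p)) (env e)) Rs"
      and Rs: "\<forall>R \<in> set Rs. occ R"
      using occ_processed[OF T] by blast
    from step show ?thesis
      using Rs Neg by cases auto
  qed
  moreover have "\<not> asat limit_fun e (Neg p)" if T: "occ (gFls (code_fm (Neg p)) (env e))"
  proof -
    obtain j a b Rs
      where step: "goal_step (N j) (L j) (num a) (num b) (gFls (code_fm (Neg p)) (env e)) Rs"
      and Rs: "\<forall>R \<in> set Rs. occ R"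
      using occ_processed[OF T] by blast
    from step show ?thesis
      using Rs Neg by cases auto
  qed
  ultimately show ?case by blast
next
  case (Conj p q)
  have "asat limit_fun e (Conj p q)" if T: "occ (gTru (code_fm (Conj p q)) (env e))"
  proof -
    obtain j a b Rs
      where step: "goal_step (N j) (L j) (num a) (num b) (gTru (code_fm (Conj p q)) (env e)) Rs"
      and Rs: "\<forall>R \<in> set Rs. occ R"
      using occ_processed[OF T] by blast
    from step show ?thesis
      using Rs Conj by cases auto
  qed
  moreover have "\<not> asat limit_fun e (Conj p q)" if T: "occ (gFls (code_fm (Conj p q)) (env e))"
  proof -
    obtain j a b Rs
      where step: "goal_step (N j) (L j) (num a) (num b) (gFls (code_fm (Conj p q)) (env e)) Rs"
      and Rs: "\<forall>R \<in> set Rs. occ R"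
      using occ_processed[OF T] by blast
    from step show ?thesis
      using Rs Conj by cases auto
  qed
  ultimately show ?case by blast
next
  case (Ex p)
  have "asat limit_fun e (Ex p)" if T: "occ (gTru (code_fm (Ex p)) (env e))"
  proof -
    obtain j a b Rs
      where step: "goal_step (N j) (L j) (num a) (num b) (gTru (code_fm (Ex p)) (env e)) Rs"
      and Rs: "\<forall>R \<in> set Rs. occ R"
      using occ_processed[OF T] by blast
    from step show ?thesis
      using Rs Ex[of "a # e"] by cases auto
  qed
  moreover have "\<not> asat limit_fun e (Ex p)" if T: "occ (gFls (code_fm (Ex p)) (env e))"
  proof -
    \<comment> \<open>Every \<open>gAll\<close> goal is treated in turn, and each yields one
      instance and its own successor, so all instances occur.\<close>
    have All: "occ (gFls (code_fm p) (env (w # e))) \<and> occ (gAll (code_fm p) (env e) (num (Suc w)))"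
      if A: "occ (gAll (code_fm p) (env e) (num w))" for w
    proof -
      obtain j a b Rs
        where step: "goal_step (N j) (L j) (num a) (num b) (gAll (code_fm p) (env e) (num w)) Rs"
        and Rs: "\<forall>R \<in> set Rs. occ R"
        using occ_processed[OF A] by blast
      from step show ?thesis using Rs by cases auto
    qed
    obtain j a b Rs where "goal_step (N j) (L j) (num a) (num b) (gFls (code_fm (Ex p)) (env e)) Rs"
      and Rs: "\<forall>R \<in> set Rs. occ R"
      using occ_processed[OF T] by blast
    then have "occ (gAll (code_fm p) (env e) (num 0))"
      using Rs by cases auto
    then have "occ (gAll (code_fm p) (env e) (num w))" for w
      by (induction w) (use All in blast)+
    then show ?thesis
      using All Ex by auto
  qed
  ultimately show ?case by blast
qed

lemma not_asat_limit: "\<not> asat limit_fun e\<^sub>0 \<phi>"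
  using occ_fm occ_start by blast

end

section \<open>Completeness: a falsifying function guides an infinite run\<close>

fun db :: "(nat \<Rightarrow> nat) \<Rightarrow> nat \<Rightarrow> trm" where
  "db \<alpha> 0 = tNil"
| "db \<alpha> (Suc j) = tCons (num (\<alpha> j)) (db \<alpha> j)"

lemma guess_add_left: "guess\<^sup>*\<^sup>* (N, L, num a, h) (N, L, num (c + a), h)"
proof (induction c)
  case (Suc c)
  then show ?case
    using guess.intros(1)[of N L "num (c + a)" h] by auto
qed simp

lemma guess_add_right: "guess\<^sup>*\<^sup>* (N, L, g, num b) (N, L, g, num (c + b))"
proof (induction c)
  case (Suc c)
  then show ?case
    using guess.intros(2)[of N L g "num (c + b)"] by auto
qed simp

lemma guess_db:
  assumes "j \<le> j'"
  shows "guess\<^sup>*\<^sup>* (num j, db \<alpha> j, tZ, tZ) (num j', db \<alpha> j', num a, num b)"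
proof -
  have "guess\<^sup>*\<^sup>* (num j, db \<alpha> j, tZ, tZ) (num j', db \<alpha> j', tZ, tZ)"
    using assms
  proof (induction j' rule: dec_induct)
    case (step j')
    note step(3)
    also have "guess\<^sup>*\<^sup>* (num j', db \<alpha> j', tZ, tZ) (num j', db \<alpha> j', num (\<alpha> j'), tZ)"
      using guess_add_left[of _ _ 0 _ "\<alpha> j'"] by simp
    also have "guess (num j', db \<alpha> j', num (\<alpha> j'), tZ) (num (Suc j'), db \<alpha> (Suc j'), tZ, tZ)"
      using guess.intros(3) by simp
    finally show ?case .
  qed simp
  also have "guess\<^sup>*\<^sup>* (num j', db \<alpha> j', tZ, tZ) (num j', db \<alpha> j', num a, tZ)"
    using guess_add_left[of _ _ 0 _ a] by simp
  also have "guess\<^sup>*\<^sup>* (num j', db \<alpha> j', num a, tZ) (num j', db \<alpha> j', num a, num b)"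
    using guess_add_right[of _ _ _ 0 b] by simp
  finally show ?thesis .
qed

fun bound_trm :: "atrm \<Rightarrow> nat \<Rightarrow> bool" where
  "bound_trm (V i) k \<longleftrightarrow> i < k"
| "bound_trm Zer k \<longleftrightarrow> True"
| "bound_trm (Sc t) k \<longleftrightarrow> bound_trm t k"
| "bound_trm (Pl t u) k \<longleftrightarrow> bound_trm t k \<and> bound_trm u k"
| "bound_trm (Tm t u) k \<longleftrightarrow> bound_trm t k \<and> bound_trm u k"
| "bound_trm (Ap t) k \<longleftrightarrow> bound_trm t k"

fun bound_fm :: "afm \<Rightarrow> nat \<Rightarrow> bool" where
  "bound_fm (Eq t u) k \<longleftrightarrow> bound_trm t k \<and> bound_trm u k"
| "bound_fm (Neg p) k \<longleftrightarrow> bound_fm p k"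
| "bound_fm (Conj p q) k \<longleftrightarrow> bound_fm p k \<and> bound_fm q k"
| "bound_fm (Ex p) k \<longleftrightarrow> bound_fm p (Suc k)"

text \<open>The goals that are true for \<alpha>, as invariant of the guided run. A lookup goal
  carries the memory from the moment it was created, so its length \<open>j\<close> is independent
  of the current one.\<close>

inductive good :: "(nat \<Rightarrow> nat) \<Rightarrow> trm \<Rightarrow> bool" for \<alpha> where
  Val: "bound_trm t (length e) \<Longrightarrow> good \<alpha> (gVal (code_trm t) (env e) (num (aval \<alpha> e t)))"
| Tru: "bound_fm p (length e) \<Longrightarrow> asat \<alpha> e p \<Longrightarrow> good \<alpha> (gTru (code_fm p) (env e))"
| Fls: "bound_fm p (length e) \<Longrightarrow> \<not> asat \<alpha> e p \<Longrightarrow> good \<alpha> (gFls (code_fm p) (env e))"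
| Add: "good \<alpha> (gAdd (num x) (num y) (num (x + y)))"
| Mul: "good \<alpha> (gMul (num x) (num y) (num (x * y)))"
| Look: "k < j \<Longrightarrow> good \<alpha> (gLook (num k) (num (\<alpha> k)) (num j) (db \<alpha> j))"
| Neq: "x \<noteq> y \<Longrightarrow> good \<alpha> (gNeq (num x) (num y))"
| All: "bound_fm p (Suc (length e)) \<Longrightarrow> (\<And>w. \<not> asat \<alpha> (w # e) p) \<Longrightarrow>
    good \<alpha> (gAll (code_fm p) (env e) (num w))"

lemma good_progress:
  assumes "good \<alpha> G"
  shows "\<exists>j' \<ge> j. \<exists>a b Rs. goal_step (num j') (db \<alpha> j') (num a) (num b) G Rs \<and> (\<forall>R \<in> set Rs. good \<alpha> R)"
proof -
  have *: ?thesis if "goal_step (num j') (db \<alpha> j') (num a) (num b) G Rs" "j \<le> j'"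
    "\<forall>R \<in> set Rs. good \<alpha> R" for j' a b Rs
    using that by blast
  from assms show ?thesis
  proof cases
    case (Val t e)
    show ?thesis
    proof (cases t)
      case (V i)
      show ?thesis
      proof (cases e)
        case Nil
        then show ?thesis using Val V by simp
      next
        case (Cons x e')
        show ?thesis
        proof (cases i)
          case 0
          then show ?thesis
            using *[of j 0 0 "[]"] by (simp add: Val V Cons goal_step.V_0)
        next
          case (Suc i')
          have "good \<alpha> (gVal (code_trm (V i')) (env e') (num (aval \<alpha> e' (V i'))))"
            by (rule good.Val) (use Val V Cons Suc in simp)
          then show ?thesis
            using *[of j 0 0
          "[gVal (code_trm (V i')) (env e') (num (aval \<alpha> e' (V i')))]"]
          goal_step.V_S
        by (simp add: Val V Cons Suc)
        qed
      qed
    next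
      case Zer
      then show ?thesis using *[of j 0 0 "[]"] by (simp add: Val goal_step.Zer)
    next
      case (Sc t')
      have "good \<alpha> (gVal (code_trm t') (env e) (num (aval \<alpha> e t')))"
        by (rule good.Val) (use Val Sc in simp)
      then show ?thesis
        using *[of j 0 0
          "[gVal (code_trm t') (env e) (num (aval \<alpha> e t'))]"]
          goal_step.Sc
        by (simp add: Val Sc)
    next
      case (Pl t1 t2)
      have "good \<alpha> (gVal (code_trm t1) (env e) (num (aval \<alpha> e t1)))"
        "good \<alpha> (gVal (code_trm t2) (env e) (num (aval \<alpha> e t2)))"
        by (rule good.Val, use Val Pl in simp)+
      then show ?thesis
        using *[of j "aval \<alpha> e t1" "aval \<alpha> e t2"
          "[gVal (code_trm t1) (env e) (num (aval \<alpha> e t1)), gVal (code_trm t2) (env e) (num (aval \<alpha> e t2)),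
            gAdd (num (aval \<alpha> e t1)) (num (aval \<alpha> e t2)) (num (aval \<alpha> e t1 + aval \<alpha> e t2))]"] goal_step.Pl good.Add
        by (simp add: Val Pl)
    next
      case (Tm t1 t2)
      have "good \<alpha> (gVal (code_trm t1) (env e) (num (aval \<alpha> e t1)))"
        "good \<alpha> (gVal (code_trm t2) (env e) (num (aval \<alpha> e t2)))"
        by (rule good.Val, use Val Tm in simp)+
      then show ?thesis
        using *[of j "aval \<alpha> e t1" "aval \<alpha> e t2"
          "[gVal (code_trm t1) (env e) (num (aval \<alpha> e t1)), gVal (code_trm t2) (env e) (num (aval \<alpha> e t2)),
            gMul (num (aval \<alpha> e t1)) (num (aval \<alpha> e t2)) (num (aval \<alpha> e t1 * aval \<alpha> e t2))]"] goal_step.Tm good.Mul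
        by (simp add: Val Tm)
    next
      case (Ap t1)
      let ?a = "aval \<alpha> e t1"
      have "good \<alpha> (gVal (code_trm t1) (env e) (num ?a))"
        by (rule good.Val) (use Val Ap in simp)
      \<comment> \<open>The new lookup goal copies the memory, so the value at \<open>?a\<close>
        must be committed beforehand: hence length at least \<open>Suc ?a\<close>.\<close>
      moreover have "good \<alpha> (gLook (num ?a) (num (\<alpha> ?a)) (num (max j (Suc ?a))) (db \<alpha> (max j (Suc ?a))))"
        by (rule good.Look) simp
      ultimately show ?thesis
        using *[of "max j (Suc ?a)" ?a 0 "[gVal (code_trm t1) (env e) (num ?a),
          gLook (num ?a) (num (\<alpha> ?a)) (num (max j (Suc ?a))) (db \<alpha> (max j (Suc ?a)))]"]
          goal_step.Ap by (simp add: Val Ap)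
    qed
  next
    case (Tru p e)
    show ?thesis
    proof (cases p)
      case (Eq t u)
      have "good \<alpha> (gVal (code_trm t) (env e) (num (aval \<alpha> e t)))"
        "good \<alpha> (gVal (code_trm u) (env e) (num (aval \<alpha> e u)))"
        by (rule good.Val, use Tru Eq in simp)+
      then show ?thesis
        using *[of j "aval \<alpha> e t" 0
          "[gVal (code_trm t) (env e) (num (aval \<alpha> e t)), gVal (code_trm u) (env e) (num (aval \<alpha> e t))]"]
          goal_step.Tru_Eq Tru
        by (simp add: Eq)
    next
      case (Neg q)
      then show ?thesis
        using *[of j 0 0
          "[gFls (code_fm q) (env e)]"]
          goal_step.Tru_Neg Tru good.Fls
        by simp
    next
      case (Conj q r)
      then show ?thesis
        using *[of j 0 0
          "[gTru (code_fm q) (env e), gTru (code_fm r) (env e)]"]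
          goal_step.Tru_Conj Tru good.Tru
        by simp
    next
      case (Ex q)
      then obtain w where "asat \<alpha> (w # e) q" using Tru by auto
      then have "good \<alpha> (gTru (code_fm q) (env (w # e)))"
        by (intro good.Tru) (use Tru Ex in auto)
      then show ?thesis
        using *[of j w 0
          "[gTru (code_fm q) (env (w # e))]"]
          goal_step.Tru_Ex
        by (simp add: Tru Ex)
    qed
  next
    case (Fls p e)
    show ?thesis
    proof (cases p)
      case (Eq t u)
      have "good \<alpha> (gVal (code_trm t) (env e) (num (aval \<alpha> e t)))"
        "good \<alpha> (gVal (code_trm u) (env e) (num (aval \<alpha> e u)))"
        by (rule good.Val, use Fls Eq in simp)+
      then show ?thesis
        using *[of j "aval \<alpha> e t" "aval \<alpha> e u"
          "[gVal (code_trm t) (env e) (num (aval \<alpha> e t)), gVal (code_trm u) (env e) (num (aval \<alpha> e u)),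
            gNeq (num (aval \<alpha> e t)) (num (aval \<alpha> e u))]"] goal_step.Fls_Eq Fls good.Neq
        by (simp add: Eq)
    next
      case (Neg q)
      then show ?thesis
        using *[of j 0 0
          "[gTru (code_fm q) (env e)]"]
          goal_step.Fls_Neg Fls good.Tru
        by simp
    next
      case (Conj q r)
      show ?thesis
      proof (cases "asat \<alpha> e q")
        case True
        then show ?thesis
          using *[of j 0 0
          "[gFls (code_fm r) (env e)]"]
          goal_step.Fls_Conj2 Fls good.Fls Conj
        by simp
      next
        case False
        then show ?thesis
          using *[of j 0 0
          "[gFls (code_fm q) (env e)]"]
          goal_step.Fls_Conj1 Fls good.Fls Conj
        by simp
      qed
    next
      case (Ex q)
      have "good \<alpha> (gAll (code_fm q) (env e) (num 0))"
        by (rule good.All) (use Fls Ex in auto)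
      then show ?thesis
        using *[of j 0 0
          "[gAll (code_fm q) (env e) (num 0)]"]
          goal_step.Fls_Ex
        by (simp add: Fls Ex)
    qed
  next
    case (Add x y)
    show ?thesis
    proof (cases x)
      case 0
      then show ?thesis using *[of j 0 0 "[]"] by (simp add: Add goal_step.Add_0)
    next
      case (Suc x')
      then show ?thesis
        using *[of j 0 0
          "[gAdd (num x') (num y) (num (x' + y))]"]
          goal_step.Add_S good.Add
        by (simp add: Add)
    qed
  next
    case (Mul x y)
    show ?thesis
    proof (cases x)
      case 0
      then show ?thesis using *[of j 0 0 "[]"] by (simp add: Mul goal_step.Mul_0)
    next
      case (Suc x')
      have "good \<alpha> (gAdd (num (x' * y)) (num y) (num (x * y)))"
        using good.Add[of \<alpha> "x' * y" y] by (simp add: Suc add.commute)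
      then show ?thesis
        using *[of j "x' * y" 0
          "[gMul (num x') (num y) (num (x' * y)), gAdd (num (x' * y)) (num y) (num (x * y))]"]
          goal_step.Mul_S good.Mul
        by (simp add: Mul Suc)
    qed
  next
    case (Look k i)
    then obtain i' where i: "i = Suc i'" by (cases i) auto
    show ?thesis
    proof (cases "k = i'")
      case True
      then show ?thesis using *[of j 0 0 "[]"] by (simp add: Look i goal_step.Look_hit)
    next
      case False
      then have "good \<alpha> (gLook (num k) (num (\<alpha> k)) (num i') (db \<alpha> i'))"
        by (intro good.Look) (use Look i in auto)
      then show ?thesis
        using *[of j 0 0
          "[gLook (num k) (num (\<alpha> k)) (num i') (db \<alpha> i')]"]
          goal_step.Look_next
        by (simp add: Look i)
    qed
  next
    case (Neq x y)
    show ?thesis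
    proof (cases x)
      case 0
      then obtain y' where "y = Suc y'" using Neq by (cases y) auto
      then show ?thesis using *[of j 0 0 "[]"] 0 by (simp add: Neq goal_step.Neq_0S)
    next
      case (Suc x')
      show ?thesis
      proof (cases y)
        case 0
        then show ?thesis using *[of j 0 0 "[]"] Suc by (simp add: Neq goal_step.Neq_S0)
      next
        case (Suc y')
        then show ?thesis
          using *[of j 0 0
          "[gNeq (num x') (num y')]"] \<open>x = Suc x'\<close> goal_step.Neq_SS good.Neq Neq by simp
      qed
    qed
  next
    case (All p e w)
    have "good \<alpha> (gFls (code_fm p) (env (w # e)))"
      by (rule good.Fls) (use All in auto)
    moreover have "good \<alpha> (gAll (code_fm p) (env e) (num (Suc w)))"
      by (rule good.All) (use All in auto)
    ultimately show ?thesis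
      using *[of j 0 0
          "[gFls (code_fm p) (env (w # e)), gAll (code_fm p) (env e) (num (Suc w))]"]
          goal_step.All
        by (simp add: All)
  qed
qed

lemma not_asat_imp_rounds:
  assumes "bound_fm \<phi> (length e)" "\<not> asat \<alpha> e \<phi>"
  shows "\<exists>C. C 0 = (tNil, tNil, tZ, tNil) \<and> (\<forall>i :: nat. round \<phi> e (C i) (C (Suc i)))"
proof -
  define P where "P C \<longleftrightarrow> (\<exists>Fs Bs j. C = (push Fs tNil, push Bs tNil, num j, db \<alpha> j) \<and>
    (\<forall>G \<in> set Fs \<union> set Bs. good \<alpha> G))" for C
  have "\<exists>C'. P C' \<and> round \<phi> e C C'" if "P C" for C
  proof -
    obtain Fs Bs j where C: "C = (push Fs tNil, push Bs tNil, num j, db \<alpha> j)"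
      and good: "\<And>G. G \<in> set Fs \<union> set Bs \<Longrightarrow> good \<alpha> G"
      using \<open>P C\<close> unfolding P_def by blast
    show ?thesis
    proof (cases Fs)
      case Nil
      let ?G = "gFls (code_fm \<phi>) (env e)"
      have "round \<phi> e C (push (?G # Bs) tNil, push [] tNil, num j, db \<alpha> j)"
        using round.swap[OF guess_db[of j j \<alpha> 0 0]] by (simp add: C Nil)
      moreover have "good \<alpha> ?G"
        using assms by (rule good.Fls)
      then have "P (push (?G # Bs) tNil, push [] tNil, num j, db \<alpha> j)"
        unfolding P_def using good
        by (intro exI[of _ "?G # Bs"] exI[of _ "[]"] exI[of _ j]) auto
      ultimately show ?thesis by blast
    next
      case (Cons G Fs')
      obtain j' a b Rs where "j \<le> j'" "goal_step (num j') (db \<alpha> j') (num a) (num b) G Rs"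
        and Rs: "\<forall>R \<in> set Rs. good \<alpha> R"
        using good_progress[of \<alpha> G j] good Cons by auto
      then have "round \<phi> e C (push Fs' tNil, push (Rs @ Bs) tNil, num j', db \<alpha> j')"
        using round.goal[OF guess_db] by (simp add: C Cons)
      moreover have "P (push Fs' tNil, push (Rs @ Bs) tNil, num j', db \<alpha> j')"
        unfolding P_def using Rs good Cons
        by (intro exI[of _ Fs'] exI[of _ "Rs @ Bs"] exI[of _ j']) auto
      ultimately show ?thesis by blast
    qed
  qed
  moreover have "P (tNil, tNil, tZ, tNil)"
    unfolding P_def by (rule exI[of _ "[]"], rule exI[of _ "[]"], rule exI[of _ 0]) simp
  ultimately obtain C where "C 0 = (tNil, tNil, tZ, tNil)" "\<And>i. round \<phi> e (C i) (C (Suc i))"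
    using dependent_nat_choice[of "\<lambda>i C. P C \<and> (i = 0 \<longrightarrow> C = (tNil, tNil, tZ, tNil))" "\<lambda>i. round \<phi> e"]
    by (metis Suc_neq_Zero)
  then show ?thesis by blast
qed

section \<open>Hardness\<close>

abbreviation start_trm :: trm where
  "start_trm \<equiv> run (mach [tNil, tNil, tZ, tNil, tZ, tZ])"

lemma SN_machine:
  assumes "\<And>\<alpha>. asat \<alpha> e \<phi>"
  shows "SN_rel (machine \<phi> e) (machine \<phi> e)"
  unfolding SN_rel_def
proof (rule allI, rule ccontr)
  fix t assume "\<not> SN_rel_on (machine \<phi> e) (machine \<phi> e) t"
  then obtain C where C: "\<And>i :: nat. round \<phi> e (C i) (C (Suc i))"
    using not_SN_imp_rounds by blast
  interpret round_sequence \<phi> e "\<lambda>i. fst (C i)" "\<lambda>i. fst (snd (C i))"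
    "\<lambda>i. fst (snd (snd (C i)))" "\<lambda>i. snd (snd (snd (C i)))"
    by unfold_locales (use C in simp)
  show False
    using not_asat_limit assms by blast
qed

lemma not_SN_machine:
  assumes "bound_fm \<phi> (length e)" "\<not> asat \<alpha> e \<phi>"
  shows "\<not> SN_rel_on (machine \<phi> e) (machine \<phi> e) start_trm"
proof -
  obtain C where "C 0 = (tNil, tNil, tZ, tNil)" "\<And>i :: nat. round \<phi> e (C i) (C (Suc i))"
    using not_asat_imp_rounds[OF assms] by blast
  then show ?thesis
    using rounds_imp_not_SN[of \<phi> e C] by simp
qed

lemma bound_trm_mono: "bound_trm t k \<Longrightarrow> k \<le> k' \<Longrightarrow> bound_trm t k'"
  by (induction t) auto

lemma bound_fm_mono: "bound_fm p k \<Longrightarrow> k \<le> k' \<Longrightarrow> bound_fm p k'"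
  by (induction p arbitrary: k k') (auto intro: bound_trm_mono)

lemma bound_trm_exists: "\<exists>k. bound_trm t k"
proof (induction t)
  case (Pl t u)
  then show ?case by (metis bound_trm.simps(4) bound_trm_mono nat_le_linear)
next
  case (Tm t u)
  then show ?case by (metis bound_trm.simps(5) bound_trm_mono nat_le_linear)
qed auto

lemma bound_fm_exists: "\<exists>k. bound_fm p k"
proof (induction p)
  case (Eq t u)
  then show ?case by (metis bound_fm.simps(1) bound_trm_exists bound_trm_mono nat_le_linear)
next
  case (Conj p q)
  then show ?case by (metis bound_fm.simps(3) bound_fm_mono nat_le_linear)
next
  case (Ex p)
  then show ?case by (metis bound_fm.simps(4) bound_fm_mono le_SucI order_refl)
qed auto

text \<open>An index beyond the end of an environment \<open>e\<close> denotes the unspecified but fixed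
  value \<open>[] ! (i - length e)\<close>; appending these constants makes all indices of a given formula
  proper ones.\<close>

definition pad :: "nat \<Rightarrow> nat list" where
  "pad k = map ((!) []) [0..<k]"

lemma nth_beyond: "length e \<le> i \<Longrightarrow> e ! i = [] ! (i - length e)"
proof (induction e arbitrary: i)
  case (Cons x e)
  then show ?case by (cases i) auto
qed simp

lemma nth_pad: "i < length e + k \<Longrightarrow> (e @ pad k) ! i = e ! i"
  by (auto simp: nth_append pad_def nth_beyond[of e i])

lemma aval_pad: "bound_trm t (length e + k) \<Longrightarrow> aval \<alpha> (e @ pad k) t = aval \<alpha> e t"
  by (induction t) (auto simp: nth_pad)

text \<open>Quantifiers extend the environment at the front, so padding at the end commutes with
  passing below them.\<close>

lemma asat_pad: "bound_fm p (length e + k) \<Longrightarrow> asat \<alpha> (e @ pad k) p \<longleftrightarrow> asat \<alpha> e p"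
proof (induction p arbitrary: e)
  case (Ex p)
  then show ?case using Ex.IH[of "n # e" for n] by simp
qed (auto simp: aval_pad)

section \<open>Computability of the reduction\<close>

lemma computable_enc_num: "computable (\<lambda>n. enc_trm (num n))"
proof -
  \<comment> \<open>The code of symbol 8 applied to a term with code \<open>y\<close>;
    \<open>Suc (prod_encode (y, 0))\<close> encodes the singleton argument list.\<close>
  let ?f = "\<lambda>y. prod_encode (1, prod_encode (8, Suc (prod_encode (y, 0))))"
  have "computable (\<lambda>y. y)"
    unfolding computable_def by (intro exI[of _ "Id 0"]) (simp add: reval_Id)
  then have "computable ?f"
    by (intro computable_pair computable_const computable_Suc)
  then have "computable (\<lambda>n. (?f ^^ n) (enc_trm tZ))"
    by (rule computable_iterate)
  moreover have "enc_trm (num n) = (?f ^^ n) (enc_trm tZ)" for n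
    by (induction n) auto
  ultimately show ?thesis by simp
qed

text \<open>Unfolding leaves a fixed nest of pairings and successors over constants, with the code
  of \<open>num n\<close> as the only varying part.\<close>

lemma computable_enc_machine: "computable (\<lambda>n. enc_trs (machine \<phi> (n # e)))"
  unfolding machine_def enc_trs_def
  by (simp del: One_nat_def) (intro computable_Suc computable_pair computable_enc_num computable_const)

text \<open>\<open>f\<close> arranges the code of one system into an instance. The system terminates
  on all terms or fails at the fixed \<open>start_trm\<close>, so it serves the uniform and the
  pointwise problems alike.\<close>

lemma Pi11_hardI:
  assumes f: "\<And>m. computable m \<Longrightarrow> computable (\<lambda>n. f (m n))"
    and SN: "\<And>M. wf_trs M \<Longrightarrow> SN_rel M M \<Longrightarrow> f (enc_trs M) \<in> B"
    and not_SN: "\<And>M. wf_trs M \<Longrightarrow> \<not> SN_rel_on M M start_trm \<Longrightarrow> f (enc_trs M) \<notin> B"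
  shows "Pi11_hard B"
  unfolding Pi11_hard_def
proof (intro allI impI)
  fix A assume "Pi11 A"
  then obtain \<phi> where \<phi>: "\<And>n. n \<in> A \<longleftrightarrow> (\<forall>\<alpha>. asat \<alpha> [n] \<phi>)"
    unfolding Pi11_def by blast
  obtain k where "bound_fm \<phi> k"
    using bound_fm_exists by blast
  \<comment> \<open>The environment is \<open>n\<close> followed by \<open>k\<close> padding
    constants, hence \<open>Suc k\<close>.\<close>
  then have k: "bound_fm \<phi> (Suc k)"
    by (rule bound_fm_mono) simp
  have pad: "asat \<alpha> (n # pad k) \<phi> \<longleftrightarrow> asat \<alpha> [n] \<phi>" for \<alpha> n
    using asat_pad[of \<phi> "[n]" k \<alpha>] k by simp
  have bound: "bound_fm \<phi> (length (n # pad k))" for n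
    using k by (simp add: pad_def)
  have "n \<in> A \<longleftrightarrow> f (enc_trs (machine \<phi> (n # pad k))) \<in> B" for n
    using \<phi> pad SN[OF wf_machine SN_machine] not_SN[OF wf_machine not_SN_machine[OF bound]]
    by metis
  moreover have "computable (\<lambda>n. f (enc_trs (machine \<phi> (n # pad k))))"
    by (rule f[OF computable_enc_machine])
  ultimately show "\<exists>h. computable h \<and> (\<forall>n. n \<in> A \<longleftrightarrow> h n \<in> B)"
    by blast
qed

lemma Pi11_hard_self: "Pi11_hard SN_self"
  by (rule Pi11_hardI[of "\<lambda>m. m"]) (auto simp: SN_self_def SN_rel_def enc_trs_inject)

lemma Pi11_hard_self_on: "Pi11_hard SN_self_on"
  by (rule Pi11_hardI[of "\<lambda>m. prod_encode (m, enc_trm start_trm)"])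
    (auto simp: SN_self_on_def SN_rel_def enc_trs_inject enc_trm_inject simp del: enc_trm.simps
      intro: computable_pair computable_const)

lemma Pi11_hard_pairs: "Pi11_hard SN_pairs"
  by (rule Pi11_hardI[of "\<lambda>m. prod_encode (m, m)"])
    (auto simp: SN_pairs_def SN_rel_def enc_trs_inject intro: computable_pair)

lemma Pi11_hard_triples: "Pi11_hard SN_triples"
  by (rule Pi11_hardI[of "\<lambda>m. prod_encode (m, prod_encode (m, enc_trm start_trm))"])
    (auto simp: SN_triples_def SN_rel_def enc_trs_inject enc_trm_inject simp del: enc_trm.simps
      intro!: computable_pair computable_const)

section \<open>Membership\<close>

text \<open>Each of these fixpoint equations determines its predicate on the codes of terms and rules, by
  recursion on the size of the code. Hence a function \<open>\<alpha>\<close> satisfying them can serve both to decide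
  these predicates and to provide the infinite reduction sequence.\<close>

locale coded_rewriting =
  fixes pr :: "nat \<Rightarrow> nat \<Rightarrow> nat"
    and tm tml :: "nat \<Rightarrow> bool"
    and nthc sub subl :: "nat \<Rightarrow> nat \<Rightarrow> nat \<Rightarrow> bool"
    and occ occl :: "nat \<Rightarrow> nat \<Rightarrow> bool"
    and wft :: "nat \<Rightarrow> bool"
    and rt st stl :: "nat \<Rightarrow> nat \<Rightarrow> nat \<Rightarrow> bool"
    and stn :: "nat \<Rightarrow> nat \<Rightarrow> nat \<Rightarrow> nat \<Rightarrow> bool"
  assumes pr: "pr a b + pr a b = (a + b) * Suc (a + b) + (a + a)"
    and tm: "tm a \<longleftrightarrow> (\<exists>x. a = pr 0 x) \<or> (\<exists>f l. a = pr (Suc 0) (pr f l) \<and> tml l)"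
    and tml: "tml a \<longleftrightarrow> a = 0 \<or> (\<exists>x l. a = Suc (pr x l) \<and> tm x \<and> tml l)"
    and nthc: "nthc s x y \<longleftrightarrow> s = 0 \<and> y = 0 \<or> (\<exists>z l. s = Suc (pr z l) \<and> x = 0 \<and> y = z) \<or>
      (\<exists>z l k. s = Suc (pr z l) \<and> x = Suc k \<and> nthc l k y)"
    and sub: "sub s a b \<longleftrightarrow> (\<exists>x. a = pr 0 x \<and> nthc s x b) \<or>
      (\<exists>f l m. a = pr (Suc 0) (pr f l) \<and> b = pr (Suc 0) (pr f m) \<and> subl s l m)"
    and subl: "subl s a b \<longleftrightarrow> a = 0 \<and> b = 0 \<or>
      (\<exists>x l y m. a = Suc (pr x l) \<and> b = Suc (pr y m) \<and> sub s x y \<and> subl s l m)"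
    and occ: "occ v a \<longleftrightarrow> a = pr 0 v \<or> (\<exists>f l. a = pr (Suc 0) (pr f l) \<and> occl v l)"
    and occl: "occl v a \<longleftrightarrow> (\<exists>x l. a = Suc (pr x l) \<and> (occ v x \<or> occl v l))"
    and wft: "wft a \<longleftrightarrow> a = 0 \<or> (\<exists>l r R. a = Suc (pr (pr l r) R) \<and> tm l \<and> tm r \<and>
      (\<exists>f m. l = pr (Suc 0) (pr f m)) \<and> (\<forall>v. occ v r \<longrightarrow> occ v l) \<and> wft R)"
    and rt: "rt R a b \<longleftrightarrow> (\<exists>l r Q. R = Suc (pr (pr l r) Q) \<and>
      ((\<exists>s. tml s \<and> sub s l a \<and> sub s r b) \<or> rt Q a b))"
    and st: "st R a b \<longleftrightarrow> rt R a b \<or>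
      (\<exists>f l m. a = pr (Suc 0) (pr f l) \<and> b = pr (Suc 0) (pr f m) \<and> stl R l m)"
    and stl: "stl R a b \<longleftrightarrow> (\<exists>x l y m. a = Suc (pr x l) \<and> b = Suc (pr y m) \<and>
      (st R x y \<and> l = m \<or> x = y \<and> stl R l m))"
    and stn: "stn R k a b \<longleftrightarrow> k = 0 \<and> a = b \<or> (\<exists>j c. k = Suc j \<and> st R a c \<and> stn R j c b)"

text \<open>A single function \<open>\<alpha>\<close> packs 16 functions \<open>\<lambda>x. \<alpha> (16 * x + i)\<close>; index 0 holds the Cantor pairing,
  indices 2 to 12 and 14 hold predicates (0 meaning true), and index 13 holds the reduction
  sequence. The pairing itself is not a polynomial over the naturals, so its arguments are combined
  by the injective polynomial \<open>(a + b)\<^sup>2 + a\<close>.\<close>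

definition app_pr :: "(nat \<Rightarrow> nat) \<Rightarrow> nat \<Rightarrow> nat \<Rightarrow> nat" where
  "app_pr \<alpha> a b = \<alpha> (16 * ((a + b) * (a + b) + a))"

definition holds1 :: "(nat \<Rightarrow> nat) \<Rightarrow> nat \<Rightarrow> nat \<Rightarrow> bool" where
  "holds1 \<alpha> i x \<longleftrightarrow> \<alpha> (16 * x + i) = 0"

definition "holds2 \<alpha> i x y \<longleftrightarrow> holds1 \<alpha> i (app_pr \<alpha> x y)"
definition "holds3 \<alpha> i x y z \<longleftrightarrow> holds1 \<alpha> i (app_pr \<alpha> x (app_pr \<alpha> y z))"
definition "holds4 \<alpha> i x y z w \<longleftrightarrow> holds1 \<alpha> i (app_pr \<alpha> x (app_pr \<alpha> y (app_pr \<alpha> z w)))"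

definition model :: "(nat \<Rightarrow> nat) \<Rightarrow> bool" where
  "model \<alpha> \<longleftrightarrow> coded_rewriting (app_pr \<alpha>) (holds1 \<alpha> 14) (holds1 \<alpha> 2) (holds3 \<alpha> 3) (holds3 \<alpha> 4)
    (holds3 \<alpha> 5) (holds2 \<alpha> 6) (holds2 \<alpha> 7) (holds1 \<alpha> 8) (holds3 \<alpha> 9) (holds3 \<alpha> 10) (holds3 \<alpha> 11)
    (holds4 \<alpha> 12)"

section \<open>The fixpoint equations as an arithmetical formula\<close>

primrec numeral_trm :: "nat \<Rightarrow> atrm" where
  "numeral_trm 0 = Zer"
| "numeral_trm (Suc n) = Sc (numeral_trm n)"

lemma aval_numeral_trm [simp]: "aval \<alpha> e (numeral_trm n) = n"
  by (induction n) auto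

definition AppF :: "nat \<Rightarrow> atrm \<Rightarrow> atrm" where
  "AppF i t = Ap (Pl (Tm (numeral_trm 16) t) (numeral_trm i))"

definition PrF :: "atrm \<Rightarrow> atrm \<Rightarrow> atrm" where
  "PrF t u = Ap (Tm (numeral_trm 16) (Pl (Tm (Pl t u) (Pl t u)) t))"

definition "VarF x = PrF Zer x"
definition "FunF f l = PrF (Sc Zer) (PrF f l)"
definition "ConsF x l = Sc (PrF x l)"
definition "P1 i t = Eq (AppF i t) Zer"
definition "P2 i t u = P1 i (PrF t u)"
definition "P3 i t u v = P1 i (PrF t (PrF u v))"
definition "P4 i t u v w = P1 i (PrF t (PrF u (PrF v w)))"
definition "AllF p = Neg (Ex (Neg p))"
definition "DisF p q = Neg (Conj (Neg p) (Neg q))"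
definition "ImpF p q = Neg (Conj p (Neg q))"
definition "IffF p q = Conj (ImpF p q) (ImpF q p)"

lemma aval_macros [simp]:
  "aval \<alpha> e (AppF i t) = \<alpha> (16 * aval \<alpha> e t + i)"
  "aval \<alpha> e (PrF t u) = app_pr \<alpha> (aval \<alpha> e t) (aval \<alpha> e u)"
  "aval \<alpha> e (VarF t) = app_pr \<alpha> 0 (aval \<alpha> e t)"
  "aval \<alpha> e (FunF t u) = app_pr \<alpha> (Suc 0) (app_pr \<alpha> (aval \<alpha> e t) (aval \<alpha> e u))"
  "aval \<alpha> e (ConsF t u) = Suc (app_pr \<alpha> (aval \<alpha> e t) (aval \<alpha> e u))"
  by (simp_all add: AppF_def PrF_def VarF_def FunF_def ConsF_def app_pr_def)

lemma asat_macros [simp]: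
  "asat \<alpha> e (P1 i t) \<longleftrightarrow> holds1 \<alpha> i (aval \<alpha> e t)"
  "asat \<alpha> e (P2 i t u) \<longleftrightarrow> holds2 \<alpha> i (aval \<alpha> e t) (aval \<alpha> e u)"
  "asat \<alpha> e (P3 i t u v) \<longleftrightarrow> holds3 \<alpha> i (aval \<alpha> e t) (aval \<alpha> e u) (aval \<alpha> e v)"
  "asat \<alpha> e (P4 i t u v w) \<longleftrightarrow> holds4 \<alpha> i (aval \<alpha> e t) (aval \<alpha> e u) (aval \<alpha> e v) (aval \<alpha> e w)"
  "asat \<alpha> e (AllF p) \<longleftrightarrow> (\<forall>n. asat \<alpha> (n # e) p)"
  "asat \<alpha> e (DisF p q) \<longleftrightarrow> asat \<alpha> e p \<or> asat \<alpha> e q"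
  "asat \<alpha> e (ImpF p q) \<longleftrightarrow> (asat \<alpha> e p \<longrightarrow> asat \<alpha> e q)"
  "asat \<alpha> e (IffF p q) \<longleftrightarrow> (asat \<alpha> e p \<longleftrightarrow> asat \<alpha> e q)"
  by (auto simp: P1_def P2_def P3_def P4_def AllF_def DisF_def ImpF_def IffF_def
      holds1_def holds2_def holds3_def holds4_def)

text \<open>The assumptions of \<open>coded_rewriting\<close> in the same order, with
  \<open>V 0\<close> the innermost bound variable. Quantifiers are nested exactly as there, so the
  equivalence is mere simplification; the final \<open>Eq Zer Zer\<close> is the neutral
  conjunct.\<close>

definition model_fm :: afm where
  "model_fm = foldr Conj
  [AllF (AllF (Eq (Pl (PrF (V 1) (V 0)) (PrF (V 1) (V 0)))
      (Pl (Tm (Pl (V 1) (V 0)) (Sc (Pl (V 1) (V 0)))) (Pl (V 1) (V 1))))),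
   AllF (IffF (P1 14 (V 0)) (DisF (Ex (Eq (V 1) (VarF (V 0))))
      (Ex (Ex (Conj (Eq (V 2) (FunF (V 1) (V 0))) (P1 2 (V 0))))))),
   AllF (IffF (P1 2 (V 0)) (DisF (Eq (V 0) Zer)
      (Ex (Ex (Conj (Eq (V 2) (ConsF (V 1) (V 0))) (Conj (P1 14 (V 1)) (P1 2 (V 0)))))))),
   AllF (AllF (AllF (IffF (P3 3 (V 2) (V 1) (V 0)) (DisF (Conj (Eq (V 2) Zer) (Eq (V 0) Zer))
      (DisF (Ex (Ex (Conj (Eq (V 4) (ConsF (V 1) (V 0))) (Conj (Eq (V 3) Zer) (Eq (V 2) (V 1))))))
      (Ex (Ex (Ex (Conj (Eq (V 5) (ConsF (V 2) (V 1)))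
        (Conj (Eq (V 4) (Sc (V 0))) (P3 3 (V 1) (V 0) (V 3)))))))))))),
   AllF (AllF (AllF (IffF (P3 4 (V 2) (V 1) (V 0))
      (DisF (Ex (Conj (Eq (V 2) (VarF (V 0))) (P3 3 (V 3) (V 0) (V 1))))
      (Ex (Ex (Ex (Conj (Eq (V 4) (FunF (V 2) (V 1))) (Conj (Eq (V 3) (FunF (V 2) (V 0)))
        (P3 5 (V 5) (V 1) (V 0))))))))))),
   AllF (AllF (AllF (IffF (P3 5 (V 2) (V 1) (V 0)) (DisF (Conj (Eq (V 1) Zer) (Eq (V 0) Zer))
      (Ex (Ex (Ex (Ex (Conj (Eq (V 5) (ConsF (V 3) (V 2))) (Conj (Eq (V 4) (ConsF (V 1) (V 0)))
        (Conj (P3 4 (V 6) (V 3) (V 1)) (P3 5 (V 6) (V 2) (V 0))))))))))))),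
   AllF (AllF (IffF (P2 6 (V 1) (V 0)) (DisF (Eq (V 0) (VarF (V 1)))
      (Ex (Ex (Conj (Eq (V 2) (FunF (V 1) (V 0))) (P2 7 (V 3) (V 0)))))))),
   AllF (AllF (IffF (P2 7 (V 1) (V 0)) (Ex (Ex (Conj (Eq (V 2) (ConsF (V 1) (V 0)))
      (DisF (P2 6 (V 3) (V 1)) (P2 7 (V 3) (V 0)))))))),
   AllF (IffF (P1 8 (V 0)) (DisF (Eq (V 0) Zer)
      (Ex (Ex (Ex (Conj (Eq (V 3) (ConsF (PrF (V 2) (V 1)) (V 0))) (Conj (P1 14 (V 2))
        (Conj (P1 14 (V 1)) (Conj (Ex (Ex (Eq (V 4) (FunF (V 1) (V 0)))))
        (Conj (AllF (ImpF (P2 6 (V 0) (V 2)) (P2 6 (V 0) (V 3)))) (P1 8 (V 0)))))))))))),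
   AllF (AllF (AllF (IffF (P3 9 (V 2) (V 1) (V 0))
      (Ex (Ex (Ex (Conj (Eq (V 5) (ConsF (PrF (V 2) (V 1)) (V 0)))
        (DisF (Ex (Conj (P1 2 (V 0)) (Conj (P3 4 (V 0) (V 3) (V 5)) (P3 4 (V 0) (V 2) (V 4)))))
          (P3 9 (V 0) (V 4) (V 3)))))))))),
   AllF (AllF (AllF (IffF (P3 10 (V 2) (V 1) (V 0)) (DisF (P3 9 (V 2) (V 1) (V 0))
      (Ex (Ex (Ex (Conj (Eq (V 4) (FunF (V 2) (V 1))) (Conj (Eq (V 3) (FunF (V 2) (V 0)))
        (P3 11 (V 5) (V 1) (V 0))))))))))),
   AllF (AllF (AllF (IffF (P3 11 (V 2) (V 1) (V 0))
      (Ex (Ex (Ex (Ex (Conj (Eq (V 5) (ConsF (V 3) (V 2))) (Conj (Eq (V 4) (ConsF (V 1) (V 0)))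
        (DisF (Conj (P3 10 (V 6) (V 3) (V 1)) (Eq (V 2) (V 0)))
          (Conj (Eq (V 3) (V 1)) (P3 11 (V 6) (V 2) (V 0))))))))))))),
   AllF (AllF (AllF (AllF (IffF (P4 12 (V 3) (V 2) (V 1) (V 0))
      (DisF (Conj (Eq (V 2) Zer) (Eq (V 1) (V 0)))
      (Ex (Ex (Conj (Eq (V 4) (Sc (V 1))) (Conj (P3 10 (V 5) (V 3) (V 0))
        (P4 12 (V 5) (V 1) (V 0) (V 2)))))))))))] (Eq Zer Zer)"

lemma asat_model_fm: "asat \<alpha> e model_fm \<longleftrightarrow> model \<alpha>"
  unfolding model_def coded_rewriting_def model_fm_def by simp

section \<open>Solutions agree with the notions on terms\<close>

context coded_rewriting
begin

text \<open>The assumption on \<open>pr\<close> is the Cantor pairing doubled, which avoids the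
  division by two in triangle numbers.\<close>

lemma pr_eq: "pr a b = prod_encode (a, b)"
proof -
  have "triangle n + triangle n = n * Suc n" for n
    by (induction n) auto
  from this[of "a + b"] show ?thesis
    using pr[of a b] by (simp add: prod_encode_def)
qed

lemma enc_Var: "enc_trm (Var x) = pr 0 x"
  by (simp add: pr_eq)

lemma enc_Fun: "enc_trm (Fun f ts) = pr (Suc 0) (pr f (list_encode (map enc_trm ts)))"
  by (simp add: pr_eq)

lemma list_encode_Cons: "list_encode (x # xs) = Suc (pr x (list_encode xs))"
  by (simp add: pr_eq)

lemma pr_inject [simp]: "pr a b = pr c d \<longleftrightarrow> a = c \<and> b = d"
  by (simp add: pr_eq)

lemma le_pr: "a \<le> pr a b" "b \<le> pr a b"
  by (simp_all add: pr_eq le_prod_encode_1 le_prod_encode_2)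

text \<open>The bounds of \<open>le_pr\<close> are not strict, as \<open>pr 0 0 = 0\<close>; the tag
  \<open>Suc 0\<close> makes recursion from an application to its argument list
  well-founded.\<close>

lemma less_pr: "b < pr (Suc 0) b"
  by (simp add: pr_eq prod_encode_def)

lemmas code_simps = enc_Var enc_Fun list_encode_Cons list_encode.simps(1)

declare enc_trm.simps [simp del] list_encode.simps [simp del]

lemma tml_enc:
  "(\<And>t. t \<in> set ts \<Longrightarrow> tm (enc_trm t)) \<Longrightarrow> tml (list_encode (map enc_trm ts))"
  by (induction ts) (auto simp: code_simps tml[of 0] tml[of "Suc _"])

lemma tm_enc: "tm (enc_trm t)"
proof (induction t)
  case (Var x)
  then show ?case by (subst tm) (auto simp: code_simps)
next
  case (Fun f ts)
  then show ?case using tml_enc by (subst tm) (auto simp: code_simps)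
qed

lemma tm_tml_decode:
  "(tm a \<longrightarrow> (\<exists>t. a = enc_trm t)) \<and> (tml a \<longrightarrow> (\<exists>ts. a = list_encode (map enc_trm ts)))"
proof (induction a rule: less_induct)
  case (less a)
  have "\<exists>t. a = enc_trm t" if "tm a"
  proof -
    from that consider x where "a = pr 0 x" | f l where "a = pr (Suc 0) (pr f l)" "tml l"
      by (subst (asm) tm) blast
    then show ?thesis
    proof cases
      case 1
      then show ?thesis using enc_Var by metis
    next
      case 2
      then have "l < a"
        using less_pr[of "pr f l"] le_pr(2)[of l f] by simp
      then show ?thesis
        using less 2 enc_Fun by metis
    qed
  qed
  moreover have "\<exists>ts. a = list_encode (map enc_trm ts)" if "tml a"
  proof -
    from that consider "a = 0" | x l where "a = Suc (pr x l)" "tm x" "tml l"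
      by (subst (asm) tml) blast
    then show ?thesis
    proof cases
      case 1
      then show ?thesis by (intro exI[of _ "[]"]) (simp add: code_simps)
    next
      case 2
      then have "x < a" "l < a"
        using le_pr[of x l] le_pr(2)[of l x] by simp_all
      then obtain t ts where "x = enc_trm t" "l = list_encode (map enc_trm ts)"
        using less 2 by blast
      then show ?thesis
        using 2 by (intro exI[of _ "t # ts"]) (simp add: code_simps)
    qed
  qed
  ultimately show ?case by blast
qed

lemma tm_iff: "tm a \<longleftrightarrow> (\<exists>t. a = enc_trm t)"
  using tm_enc tm_tml_decode by blast

lemma tml_iff: "tml a \<longleftrightarrow> (\<exists>ts. a = list_encode (map enc_trm ts))"
  using tm_enc tml_enc tm_tml_decode by blast

text \<open>The default \<open>Var 0\<close> has code 0, which is what \<open>nthc\<close> yields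
  beyond the end of a list.\<close>

definition list_subst :: "trm list \<Rightarrow> nat \<Rightarrow> trm" where
  "list_subst ts i = (if i < length ts then ts ! i else Var 0)"

lemma nthc_iff:
  "nthc (list_encode (map enc_trm ts)) i y \<longleftrightarrow> y = enc_trm (list_subst ts i)"
proof (induction ts arbitrary: i)
  case Nil
  have "pr 0 0 = 0" using pr[of 0 0] by simp
  then show ?case by (subst nthc) (simp add: list_subst_def code_simps)
next
  case (Cons t ts)
  then show ?case
    by (subst nthc, cases i) (auto simp: list_subst_def code_simps)
qed

lemma subl_iff:
  "(\<And>t y. t \<in> set ts \<Longrightarrow> sub s (enc_trm t) y \<longleftrightarrow> y = enc_trm (\<theta> t)) \<Longrightarrow>
    subl s (list_encode (map enc_trm ts)) y \<longleftrightarrow> y = list_encode (map enc_trm (map \<theta> ts))"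
proof (induction ts arbitrary: y)
  case Nil
  show ?case by (subst subl) (simp add: code_simps)
next
  case (Cons t ts)
  then show ?case by (subst subl) (auto simp: code_simps)
qed

lemma sub_iff:
  "sub (list_encode (map enc_trm ts)) (enc_trm t) y \<longleftrightarrow> y = enc_trm (subst (list_subst ts) t)"
proof (induction t arbitrary: y)
  case (Var x)
  show ?case by (subst sub) (simp add: code_simps nthc_iff)
next
  case (Fun f us)
  then show ?case
    by (subst sub) (simp add: code_simps subl_iff[of us _ "subst (list_subst ts)"])
qed

lemma occl_iff:
  "(\<And>t. t \<in> set ts \<Longrightarrow> occ v (enc_trm t) \<longleftrightarrow> v \<in> vars t) \<Longrightarrow>
    occl v (list_encode (map enc_trm ts)) \<longleftrightarrow> (\<exists>t \<in> set ts. v \<in> vars t)"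
proof (induction ts)
  case Nil
  show ?case by (subst occl) (simp add: code_simps)
next
  case (Cons t ts)
  then show ?case by (subst occl) (auto simp: code_simps)
qed

lemma occ_iff: "occ v (enc_trm t) \<longleftrightarrow> v \<in> vars t"
proof (induction t)
  case (Var x)
  show ?case by (subst occ) (auto simp: code_simps)
next
  case (Fun f us)
  then show ?case by (subst occ) (simp add: code_simps occl_iff)
qed

lemma enc_trs_code:
  "enc_trs [] = 0" "enc_trs ((l, r) # R) = Suc (pr (pr (enc_trm l) (enc_trm r)) (enc_trs R))"
  by (simp_all add: enc_trs_def code_simps pr_eq)

lemma wft_enc: "wf_trs R \<Longrightarrow> wft (enc_trs R)"
proof (induction R)
  case Nil
  show ?case by (subst wft) (simp add: enc_trs_code)
next
  case (Cons lr R)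
  obtain l r where "lr = (l, r)" by (cases lr)
  then show ?case
    using Cons by (subst wft) (auto simp: enc_trs_code wf_trs_def tm_enc occ_iff code_simps)
qed

lemma wft_decode: "wft a \<Longrightarrow> \<exists>R. wf_trs R \<and> a = enc_trs R"
proof (induction a rule: less_induct)
  case (less a)
  from less(2) consider "a = 0" | l r R where "a = Suc (pr (pr l r) R)" "tm l" "tm r"
    "\<exists>f m. l = pr (Suc 0) (pr f m)" "\<forall>v. occ v r \<longrightarrow> occ v l" "wft R"
    by (subst (asm) wft) blast
  then show ?case
  proof cases
    case 1
    then show ?thesis
      by (intro exI[of _ "[]"]) (simp add: enc_trs_code wf_trs_def)
  next
    case 2
    obtain t u where tu: "l = enc_trm t" "r = enc_trm u"
      using 2 tm_iff by blast
    have "R < a"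
      using le_pr(2)[of R "pr l r"] 2 by simp
    then obtain Q where Q: "wf_trs Q" "R = enc_trs Q"
      using less(1) 2 by blast
    have "\<exists>f ts. t = Fun f ts"
      using 2(4) tu by (cases t) (auto simp: code_simps)
    moreover have "vars u \<subseteq> vars t"
      using 2(5) tu by (auto simp: occ_iff)
    ultimately have "wf_trs ((t, u) # Q)"
      using Q by (simp add: wf_trs_def)
    moreover have "a = enc_trs ((t, u) # Q)"
      using 2 tu Q by (simp add: enc_trs_code)
    ultimately show ?thesis by blast
  qed
qed

lemma wft_iff: "wft a \<longleftrightarrow> (\<exists>R. wf_trs R \<and> a = enc_trs R)"
  using wft_enc wft_decode by blast

lemma subst_cong_vars: "(\<And>x. x \<in> vars t \<Longrightarrow> \<sigma> x = \<tau> x) \<Longrightarrow> subst \<sigma> t = subst \<tau> t"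
  by (induction t) auto

lemma finite_vars: "finite (vars t)"
  by (induction t) auto

text \<open>Only the finitely many variables of a rule matter, so a finite list, and hence a number,
  can replace the substitution.\<close>

lemma subst_finite:
  "(\<exists>\<sigma>. s = subst \<sigma> l \<and> t = subst \<sigma> r) \<longleftrightarrow>
   (\<exists>ts. s = subst (list_subst ts) l \<and> t = subst (list_subst ts) r)"
proof
  assume "\<exists>\<sigma>. s = subst \<sigma> l \<and> t = subst \<sigma> r"
  then obtain \<sigma> where \<sigma>: "s = subst \<sigma> l" "t = subst \<sigma> r" by blast
  obtain k where k: "\<And>x. x \<in> vars l \<union> vars r \<Longrightarrow> x < k"
    using finite_vars finite_nat_set_iff_bounded[of "vars l \<union> vars r"] by auto
  have "s = subst (list_subst (map \<sigma> [0..<k])) l" "t = subst (list_subst (map \<sigma> [0..<k])) r"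
    unfolding \<sigma> by (rule subst_cong_vars, use k in \<open>simp add: list_subst_def\<close>)+
  then show "\<exists>ts. s = subst (list_subst ts) l \<and> t = subst (list_subst ts) r" by blast
qed blast

lemma rt_iff: "rt (enc_trs R) (enc_trm s) y \<longleftrightarrow> (\<exists>t. y = enc_trm t \<and> root_step R s t)"
proof (induction R)
  case Nil
  show ?case by (subst rt) (simp add: enc_trs_code root_step_def)
next
  case (Cons lr R)
  obtain l r where lr: "lr = (l, r)" by (cases lr)
  have root: "root_step (lr # R) s t \<longleftrightarrow>
    (\<exists>\<sigma>. s = subst \<sigma> l \<and> t = subst \<sigma> r) \<or> root_step R s t" for t
    by (auto simp: root_step_def lr)
  have "rt (enc_trs (lr # R)) (enc_trm s) y \<longleftrightarrow>
    (\<exists>ts. s = subst (list_subst ts) l \<and> y = enc_trm (subst (list_subst ts) r)) \<or>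
    rt (enc_trs R) (enc_trm s) y"
    by (subst rt) (auto simp: lr enc_trs_code tml_iff sub_iff enc_trm_inject)
  also have "\<dots> \<longleftrightarrow> (\<exists>t. y = enc_trm t \<and>
    (\<exists>ts. s = subst (list_subst ts) l \<and> t = subst (list_subst ts) r)) \<or>
    (\<exists>t. y = enc_trm t \<and> root_step R s t)"
    unfolding Cons by blast
  also have "\<dots> \<longleftrightarrow> (\<exists>t. y = enc_trm t \<and> root_step (lr # R) s t)"
    unfolding subst_finite[symmetric] root by blast
  finally show ?case .
qed

lemma stl_iff:
  "(\<And>s y. s \<in> set ss \<Longrightarrow> st R (enc_trm s) y \<longleftrightarrow> (\<exists>t. y = enc_trm t \<and> \<rho> s t)) \<Longrightarrow>
    stl R (list_encode (map enc_trm ss)) y \<longleftrightarrow>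
    (\<exists>ss1 s t ss2. ss = ss1 @ s # ss2 \<and> \<rho> s t \<and> y = list_encode (map enc_trm (ss1 @ t # ss2)))"
proof (induction ss arbitrary: y)
  case Nil
  show ?case by (subst stl) (simp add: code_simps)
next
  case (Cons s ss)
  have IH: "stl R (list_encode (map enc_trm ss)) m \<longleftrightarrow>
    (\<exists>ss1 s t ss2. ss = ss1 @ s # ss2 \<and> \<rho> s t \<and> m = list_encode (map enc_trm (ss1 @ t # ss2)))" for m
    using Cons by simp
  have "stl R (list_encode (map enc_trm (s # ss))) y \<longleftrightarrow>
    (\<exists>t. \<rho> s t \<and> y = list_encode (map enc_trm (t # ss))) \<or>
    (\<exists>m. stl R (list_encode (map enc_trm ss)) m \<and> y = Suc (pr (enc_trm s) m))"
    using Cons.prems by (subst stl) (auto simp: code_simps)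
  also have "\<dots> \<longleftrightarrow> (\<exists>t. \<rho> s t \<and> y = list_encode (map enc_trm (t # ss))) \<or>
    (\<exists>ss1 s' t ss2. ss = ss1 @ s' # ss2 \<and> \<rho> s' t \<and>
      y = list_encode (map enc_trm (s # ss1 @ t # ss2)))"
    unfolding IH list.map list_encode_Cons by blast
  also have "\<dots> \<longleftrightarrow> (\<exists>ss1 s' t ss2. s # ss = ss1 @ s' # ss2 \<and> \<rho> s' t \<and>
      y = list_encode (map enc_trm (ss1 @ t # ss2)))"
    (is "?H \<or> ?T \<longleftrightarrow> ?L")
  proof
    assume "?H \<or> ?T"
    then show ?L
      by (metis append_Cons append_Nil)
  next
    assume ?L
    then obtain ss1 s' t ss2 where "s # ss = ss1 @ s' # ss2" "\<rho> s' t"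
      "y = list_encode (map enc_trm (ss1 @ t # ss2))" by blast
    then show "?H \<or> ?T"
      by (cases ss1) (simp, blast, simp only: append_Cons list.inject, blast)
  qed
  finally show ?case .
qed

lemma st_iff: "st (enc_trs R) (enc_trm s) y \<longleftrightarrow> (\<exists>t. y = enc_trm t \<and> rstep R s t)"
proof (induction s arbitrary: y)
  case (Var x)
  show ?case
    by (subst st) (auto simp: code_simps rt_iff[unfolded enc_Var] rstep.simps[of R "Var x"]
        rt_iff[of R "Var x", unfolded enc_Var])
next
  case (Fun f ss)
  have stl: "stl (enc_trs R) (list_encode (map enc_trm ss)) m \<longleftrightarrow>
    (\<exists>ss1 s t ss2. ss = ss1 @ s # ss2 \<and> rstep R s t \<and>
      m = list_encode (map enc_trm (ss1 @ t # ss2)))" for m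
    by (rule stl_iff) (rule Fun)
  have rstep: "rstep R (Fun f ss) t \<longleftrightarrow> root_step R (Fun f ss) t \<or>
    (\<exists>ss1 s u ss2. ss = ss1 @ s # ss2 \<and> t = Fun f (ss1 @ u # ss2) \<and> rstep R s u)" for t
    by (subst rstep.simps) auto
  have "st (enc_trs R) (enc_trm (Fun f ss)) y \<longleftrightarrow> rt (enc_trs R) (enc_trm (Fun f ss)) y \<or>
    (\<exists>m. stl (enc_trs R) (list_encode (map enc_trm ss)) m \<and> y = pr (Suc 0) (pr f m))"
    by (subst st) (auto simp: code_simps)
  also have "\<dots> \<longleftrightarrow> (\<exists>t. y = enc_trm t \<and> root_step R (Fun f ss) t) \<or>
    (\<exists>ss1 s t ss2. ss = ss1 @ s # ss2 \<and> rstep R s t \<and> y = enc_trm (Fun f (ss1 @ t # ss2)))"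
    unfolding rt_iff stl unfolding enc_Fun by blast
  also have "\<dots> \<longleftrightarrow> (\<exists>t. y = enc_trm t \<and> rstep R (Fun f ss) t)"
    unfolding rstep by blast
  finally show ?case .
qed

text \<open>The counter \<open>k\<close> makes the equation determine the relation. An equation for
  the reflexive transitive closure itself may have larger solutions, since steps need not shrink
  codes.\<close>

lemma stn_iff:
  "stn (enc_trs R) k (enc_trm s) y \<longleftrightarrow> (\<exists>t. y = enc_trm t \<and> (rstep R ^^ k) s t)"
proof (induction k arbitrary: s)
  case 0
  show ?case by (subst stn) auto
next
  case (Suc k)
  have "stn (enc_trs R) (Suc k) (enc_trm s) y \<longleftrightarrow>
    (\<exists>u. rstep R s u \<and> stn (enc_trs R) k (enc_trm u) y)"
    by (subst stn) (auto simp: st_iff)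
  then show ?case
    unfolding Suc by (metis relpowp_Suc_D2 relpowp_Suc_I2)
qed

lemma steps_iff:
  "(\<exists>k c. stn (enc_trs S) k (enc_trm s) c \<and> rt (enc_trs R) c y) \<longleftrightarrow>
   (\<exists>t. y = enc_trm t \<and> ((rstep S)\<^sup>*\<^sup>* OO root_step R) s t)"
  by (auto simp: stn_iff rt_iff rtranclp_power relcompp_apply) (use rt_iff in blast)+

lemma coded_sequence_imp_not_SN:
  assumes u: "u 0 = enc_trm t"
    "\<And>i. \<exists>k c. stn (enc_trs S) k (u i) c \<and> rt (enc_trs R) c (u (Suc i))"
  shows "\<not> SN_rel_on R S t"
proof -
  \<comment> \<open>Only \<open>u 0\<close> is known to be a term code; the other values inherit
    this because steps from codes lead to codes.\<close>
  have "\<exists>s. u i = enc_trm s" for i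
  proof (induction i)
    case (Suc i)
    then show ?case using u(2)[of i] steps_iff by metis
  qed (use u in blast)
  then obtain f where f: "\<And>i. u i = enc_trm (f i)" by metis
  have "((rstep S)\<^sup>*\<^sup>* OO root_step R) (f i) (f (Suc i))" for i
    using u(2)[of i] steps_iff[of S "f i" R "u (Suc i)"] by (simp add: f enc_trm_inject)
  moreover have "f 0 = t"
    using u(1) by (simp add: f enc_trm_inject)
  ultimately show ?thesis
    unfolding SN_rel_on_def by blast
qed

end

section \<open>Existence of a solution\<close>

inductive tm_code :: "nat \<Rightarrow> bool" and tml_code :: "nat \<Rightarrow> bool" where
  "tm_code (prod_encode (0, x))"
| "tml_code l \<Longrightarrow> tm_code (prod_encode (Suc 0, prod_encode (f, l)))"
| "tml_code 0"
| "tm_code x \<Longrightarrow> tml_code l \<Longrightarrow> tml_code (Suc (prod_encode (x, l)))"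

inductive nth_code :: "nat \<Rightarrow> nat \<Rightarrow> nat \<Rightarrow> bool" where
  "nth_code 0 x 0"
| "nth_code (Suc (prod_encode (z, l))) 0 z"
| "nth_code l k y \<Longrightarrow> nth_code (Suc (prod_encode (z, l))) (Suc k) y"

inductive sub_code :: "nat \<Rightarrow> nat \<Rightarrow> nat \<Rightarrow> bool" and subl_code :: "nat \<Rightarrow> nat \<Rightarrow> nat \<Rightarrow> bool"
  for s where
  "nth_code s x y \<Longrightarrow> sub_code s (prod_encode (0, x)) y"
| "subl_code s l m \<Longrightarrow>
    sub_code s (prod_encode (Suc 0, prod_encode (f, l))) (prod_encode (Suc 0, prod_encode (f, m)))"
| "subl_code s 0 0"
| "sub_code s x y \<Longrightarrow> subl_code s l m \<Longrightarrow>
    subl_code s (Suc (prod_encode (x, l))) (Suc (prod_encode (y, m)))"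

inductive occ_code :: "nat \<Rightarrow> nat \<Rightarrow> bool" and occl_code :: "nat \<Rightarrow> nat \<Rightarrow> bool" for v where
  "occ_code v (prod_encode (0, v))"
| "occl_code v l \<Longrightarrow> occ_code v (prod_encode (Suc 0, prod_encode (f, l)))"
| "occ_code v x \<Longrightarrow> occl_code v (Suc (prod_encode (x, l)))"
| "occl_code v l \<Longrightarrow> occl_code v (Suc (prod_encode (x, l)))"

inductive wft_code :: "nat \<Rightarrow> bool" where
  "wft_code 0"
| "l = prod_encode (Suc 0, prod_encode (f, m)) \<Longrightarrow> tm_code l \<Longrightarrow> tm_code r \<Longrightarrow>
    \<forall>v. occ_code v r \<longrightarrow> occ_code v l \<Longrightarrow> wft_code R \<Longrightarrow>
    wft_code (Suc (prod_encode (prod_encode (l, r), R)))"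

inductive rt_code :: "nat \<Rightarrow> nat \<Rightarrow> nat \<Rightarrow> bool" where
  "tml_code s \<Longrightarrow> sub_code s l a \<Longrightarrow> sub_code s r b \<Longrightarrow>
    rt_code (Suc (prod_encode (prod_encode (l, r), Q))) a b"
| "rt_code Q a b \<Longrightarrow> rt_code (Suc (prod_encode (prod_encode (l, r), Q))) a b"

inductive st_code :: "nat \<Rightarrow> nat \<Rightarrow> nat \<Rightarrow> bool" and stl_code :: "nat \<Rightarrow> nat \<Rightarrow> nat \<Rightarrow> bool"
  for R where
  "rt_code R a b \<Longrightarrow> st_code R a b"
| "stl_code R l m \<Longrightarrow>
    st_code R (prod_encode (Suc 0, prod_encode (f, l))) (prod_encode (Suc 0, prod_encode (f, m)))"
| "st_code R x y \<Longrightarrow> stl_code R (Suc (prod_encode (x, l))) (Suc (prod_encode (y, l)))"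
| "stl_code R l m \<Longrightarrow> stl_code R (Suc (prod_encode (x, l))) (Suc (prod_encode (x, m)))"

inductive stn_code :: "nat \<Rightarrow> nat \<Rightarrow> nat \<Rightarrow> nat \<Rightarrow> bool" for R where
  "stn_code R 0 a a"
| "st_code R a c \<Longrightarrow> stn_code R k c b \<Longrightarrow> stn_code R (Suc k) a b"

text \<open>The predicates are least fixpoints on numbers rather than images of notions on terms, so
  the equations hold for every number, whether it is a code or not.\<close>

lemma coded_rewriting_code:
  "coded_rewriting (\<lambda>a b. prod_encode (a, b)) tm_code tml_code nth_code sub_code subl_code
    occ_code occl_code wft_code rt_code st_code stl_code stn_code"
proof
  have triangle: "triangle n + triangle n = n * Suc n" for n
    by (induction n) auto
  show "prod_encode (a, b) + prod_encode (a, b) = (a + b) * Suc (a + b) + (a + a)" for a b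
    using triangle[of "a + b"] by (simp add: prod_encode_def)
qed (subst tm_code.simps tml_code.simps nth_code.simps sub_code.simps subl_code.simps
    occ_code.simps occl_code.simps wft_code.simps rt_code.simps st_code.simps stl_code.simps
    stn_code.simps, blast)+

text \<open>As \<open>a \<le> a + b\<close>, the value lies between the square of
  \<open>a + b\<close> and the next square, so it determines \<open>a + b\<close> and then
  \<open>a\<close>.\<close>

lemma square_pairing_inject:
  fixes a b c d :: nat
  assumes "(a + b) * (a + b) + a = (c + d) * (c + d) + c"
  shows "a = c \<and> b = d"
proof -
  have less: "m * m + x < n * n + y" if "m < n" "x \<le> m" for m n x y :: nat
  proof -
    have "m * m + x < Suc m * Suc m" using that(2) by simp
    also have "\<dots> \<le> n * n" using that(1) by (intro mult_le_mono) auto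
    finally show ?thesis by simp
  qed
  have "a + b = c + d"
    using less[of "a + b" "c + d" a c] less[of "c + d" "a + b" c a] assms
    by (metis le_add1 less_irrefl nat_neq_iff)
  then show ?thesis using assms by simp
qed

lemma model_exists: "\<exists>\<alpha>. model \<alpha> \<and> (\<forall>i. \<alpha> (16 * i + 13) = u i)"
proof -
  define T where "T P x \<longleftrightarrow> (\<exists>a b c. x = prod_encode (a, prod_encode (b, c)) \<and> P a b c)"
    for P :: "nat \<Rightarrow> nat \<Rightarrow> nat \<Rightarrow> bool" and x
  define D where "D P x \<longleftrightarrow> (\<exists>a b. x = prod_encode (a, b) \<and> P a b)"
    for P :: "nat \<Rightarrow> nat \<Rightarrow> bool" and x
  have T [simp]: "T P (prod_encode (a, prod_encode (b, c))) = P a b c" for P a b c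
    unfolding T_def by auto
  have D [simp]: "D P (prod_encode (a, b)) = P a b" for P a b
    unfolding D_def by auto
  \<comment> \<open>List positions are the predicate indices used in \<open>model\<close>.\<close>
  define Ps where "Ps = [\<lambda>x. True, \<lambda>x. True, tml_code, T nth_code, T sub_code, T subl_code,
    D occ_code, D occl_code, wft_code, T rt_code, T st_code, T stl_code,
    D (\<lambda>R. T (stn_code R)), \<lambda>x. True, tm_code]"
  \<comment> \<open>\<open>THE p\<close> inverts the polynomial by which \<open>app_pr\<close>
    combines its arguments; \<open>app_pr\<close> never queries numbers outside its range.\<close>
  define \<alpha> where "\<alpha> m = (let i = m mod 16; x = m div 16 in
    if i = 0 then THE p. \<exists>a b. x = (a + b) * (a + b) + a \<and> p = prod_encode (a, b)
    else if i = 13 then u x else if (Ps ! i) x then 0 else 1)" for m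
  have "app_pr \<alpha> a b = prod_encode (a, b)" for a b
    unfolding app_pr_def \<alpha>_def Let_def
    by (auto intro!: the_equality dest: square_pairing_inject)
  then have pr: "app_pr \<alpha> = (\<lambda>a b. prod_encode (a, b))"
    by blast
  have holds: "holds1 \<alpha> i x \<longleftrightarrow> (Ps ! i) x" if "i \<noteq> 0" "i < 16" "i \<noteq> 13" for i x
    using that unfolding holds1_def \<alpha>_def Let_def by simp
  have "holds1 \<alpha> 14 = tm_code" "holds1 \<alpha> 2 = tml_code" "holds1 \<alpha> 8 = wft_code"
    by (simp_all add: holds Ps_def fun_eq_iff)
  then have "model \<alpha>"
    using coded_rewriting_code
    unfolding model_def pr holds2_def holds3_def holds4_def
    by (simp add: holds Ps_def)
  moreover have "\<alpha> (16 * i + 13) = u i" for i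
    unfolding \<alpha>_def Let_def by simp
  ultimately show ?thesis by blast
qed

text \<open>\<open>r\<close> and \<open>s\<close> are the variable indices of the two systems
  outside this formula; its three quantifiers shift them by 3.\<close>

definition chain_fm :: "nat \<Rightarrow> nat \<Rightarrow> afm" where
  "chain_fm r s = AllF (Ex (Ex (Conj (P4 12 (V (s + 3)) (V 1) (AppF 13 (V 2)) (V 0))
    (P3 9 (V (r + 3)) (V 0) (AppF 13 (Sc (V 2)))))))"

definition triples_fm :: afm where
  "triples_fm = ImpF model_fm (Ex (Ex (Ex (Conj (Eq (V 3) (PrF (V 2) (PrF (V 1) (V 0))))
    (Conj (P1 8 (V 2)) (Conj (P1 8 (V 1)) (Conj (P1 14 (V 0))
      (Neg (Conj (Eq (AppF 13 Zer) (V 0)) (chain_fm 2 1))))))))))"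

text \<open>The starting term is not part of the instance: it is read off the stored sequence and
  must be checked to be a term code.\<close>

definition pairs_fm :: afm where
  "pairs_fm = ImpF model_fm (Ex (Ex (Conj (Eq (V 2) (PrF (V 1) (V 0)))
    (Conj (P1 8 (V 1)) (Conj (P1 8 (V 0))
      (Neg (Conj (P1 14 (AppF 13 Zer)) (chain_fm 1 0))))))))"

definition chain :: "(nat \<Rightarrow> nat) \<Rightarrow> nat \<Rightarrow> nat \<Rightarrow> bool" where
  "chain \<alpha> r s \<longleftrightarrow> (\<forall>i. \<exists>k c. holds4 \<alpha> 12 s k (\<alpha> (16 * i + 13)) c \<and>
    holds3 \<alpha> 9 r c (\<alpha> (16 * Suc i + 13)))"

lemma asat_triples_fm:
  "asat \<alpha> [n] triples_fm \<longleftrightarrow> (model \<alpha> \<longrightarrow> (\<exists>r s t. n = app_pr \<alpha> r (app_pr \<alpha> s t) \<and>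
    holds1 \<alpha> 8 r \<and> holds1 \<alpha> 8 s \<and> holds1 \<alpha> 14 t \<and> \<not> (\<alpha> 13 = t \<and> chain \<alpha> r s)))"
  by (simp add: triples_fm_def chain_fm_def asat_model_fm chain_def)

lemma asat_pairs_fm:
  "asat \<alpha> [n] pairs_fm \<longleftrightarrow> (model \<alpha> \<longrightarrow> (\<exists>r s. n = app_pr \<alpha> r s \<and>
    holds1 \<alpha> 8 r \<and> holds1 \<alpha> 8 s \<and> \<not> (holds1 \<alpha> 14 (\<alpha> 13) \<and> chain \<alpha> r s)))"
  by (simp add: pairs_fm_def chain_fm_def asat_model_fm chain_def)

lemma chain_imp_not_SN:
  assumes "model \<alpha>" "chain \<alpha> (enc_trs R) (enc_trs S)" "\<alpha> 13 = enc_trm t"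
  shows "\<not> SN_rel_on R S t"
proof -
  interpret coded_rewriting "app_pr \<alpha>" "holds1 \<alpha> 14" "holds1 \<alpha> 2" "holds3 \<alpha> 3" "holds3 \<alpha> 4"
    "holds3 \<alpha> 5" "holds2 \<alpha> 6" "holds2 \<alpha> 7" "holds1 \<alpha> 8" "holds3 \<alpha> 9" "holds3 \<alpha> 10" "holds3 \<alpha> 11"
    "holds4 \<alpha> 12"
    using assms(1) unfolding model_def .
  show ?thesis
    using assms(2,3) unfolding chain_def
    by (intro coded_sequence_imp_not_SN[of "\<lambda>i. \<alpha> (16 * i + 13)"]) simp_all
qed

lemma not_SN_imp_chain:
  assumes "\<not> SN_rel_on R S t"
  shows "\<exists>\<alpha>. model \<alpha> \<and> \<alpha> 13 = enc_trm t \<and> chain \<alpha> (enc_trs R) (enc_trs S)"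
proof -
  obtain f where f: "f 0 = t" "\<And>i. ((rstep S)\<^sup>*\<^sup>* OO root_step R) (f i) (f (Suc i))"
    using assms unfolding SN_rel_on_def by blast
  obtain \<alpha> where \<alpha>: "model \<alpha>" "\<And>i. \<alpha> (16 * i + 13) = enc_trm (f i)"
    using model_exists[of "\<lambda>i. enc_trm (f i)"] by blast
  interpret coded_rewriting "app_pr \<alpha>" "holds1 \<alpha> 14" "holds1 \<alpha> 2" "holds3 \<alpha> 3" "holds3 \<alpha> 4"
    "holds3 \<alpha> 5" "holds2 \<alpha> 6" "holds2 \<alpha> 7" "holds1 \<alpha> 8" "holds3 \<alpha> 9" "holds3 \<alpha> 10" "holds3 \<alpha> 11"
    "holds4 \<alpha> 12"
    using \<alpha>(1) unfolding model_def .
  have "chain \<alpha> (enc_trs R) (enc_trs S)"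
    unfolding chain_def \<alpha>(2) steps_iff using f(2) by blast
  moreover have "\<alpha> 13 = enc_trm t"
    using \<alpha>(2)[of 0] f(1) by simp
  ultimately show ?thesis using \<alpha>(1) by blast
qed

lemma model_simps:
  assumes "model \<alpha>"
  shows "app_pr \<alpha> a b = prod_encode (a, b)"
    and "holds1 \<alpha> 8 r \<longleftrightarrow> (\<exists>R. wf_trs R \<and> r = enc_trs R)"
    and "holds1 \<alpha> 14 x \<longleftrightarrow> (\<exists>t. x = enc_trm t)"
proof -
  interpret coded_rewriting "app_pr \<alpha>" "holds1 \<alpha> 14" "holds1 \<alpha> 2" "holds3 \<alpha> 3" "holds3 \<alpha> 4"
    "holds3 \<alpha> 5" "holds2 \<alpha> 6" "holds2 \<alpha> 7" "holds1 \<alpha> 8" "holds3 \<alpha> 9" "holds3 \<alpha> 10" "holds3 \<alpha> 11"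
    "holds4 \<alpha> 12"
    using assms unfolding model_def .
  show "app_pr \<alpha> a b = prod_encode (a, b)" "holds1 \<alpha> 8 r \<longleftrightarrow> (\<exists>R. wf_trs R \<and> r = enc_trs R)"
    "holds1 \<alpha> 14 x \<longleftrightarrow> (\<exists>t. x = enc_trm t)"
    by (rule pr_eq wft_iff tm_iff)+
qed

lemma Pi11_triples: "Pi11 SN_triples"
  unfolding Pi11_def
proof (intro exI allI iffI)
  fix n \<alpha> assume "n \<in> SN_triples"
  then obtain R S t where n: "n = prod_encode (enc_trs R, prod_encode (enc_trs S, enc_trm t))"
    "wf_trs R" "wf_trs S" "SN_rel_on R S t"
    unfolding SN_triples_def by blast
  show "asat \<alpha> [n] triples_fm"
    unfolding asat_triples_fm
  proof (intro impI exI conjI)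
    assume m: "model \<alpha>"
    show "n = app_pr \<alpha> (enc_trs R) (app_pr \<alpha> (enc_trs S) (enc_trm t))" "holds1 \<alpha> 8 (enc_trs R)"
      "holds1 \<alpha> 8 (enc_trs S)" "holds1 \<alpha> 14 (enc_trm t)"
      using n by (auto simp: model_simps[OF m])
    show "\<not> (\<alpha> 13 = enc_trm t \<and> chain \<alpha> (enc_trs R) (enc_trs S))"
      using chain_imp_not_SN[OF m] n(4) by blast
  qed
next
  fix n assume sat: "\<forall>\<alpha>. asat \<alpha> [n] triples_fm"
  \<comment> \<open>Without a model the formula would hold vacuously; any single one forces
    \<open>n\<close> to decode to a valid instance.\<close>
  obtain \<alpha> where m: "model \<alpha>"
    using model_exists by blast
  obtain R S t where n: "n = prod_encode (enc_trs R, prod_encode (enc_trs S, enc_trm t))"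
    "wf_trs R" "wf_trs S"
    using sat[rule_format, of \<alpha>] m unfolding asat_triples_fm by (auto simp: model_simps[OF m])
  have "SN_rel_on R S t"
  proof (rule ccontr)
    assume "\<not> SN_rel_on R S t"
    then obtain \<beta> where \<beta>: "model \<beta>" "\<beta> 13 = enc_trm t" "chain \<beta> (enc_trs R) (enc_trs S)"
      using not_SN_imp_chain by blast
    then show False
      using sat[rule_format, of \<beta>] unfolding asat_triples_fm
      by (auto simp: model_simps[OF \<beta>(1)] n)
  qed
  then show "n \<in> SN_triples"
    using n unfolding SN_triples_def by blast
qed

lemma Pi11_pairs: "Pi11 SN_pairs"
  unfolding Pi11_def
proof (intro exI allI iffI)
  fix n \<alpha> assume "n \<in> SN_pairs"
  then obtain R S where n: "n = prod_encode (enc_trs R, enc_trs S)"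
    "wf_trs R" "wf_trs S" "SN_rel R S"
    unfolding SN_pairs_def by blast
  show "asat \<alpha> [n] pairs_fm"
    unfolding asat_pairs_fm
  proof (intro impI exI conjI)
    assume m: "model \<alpha>"
    show "n = app_pr \<alpha> (enc_trs R) (enc_trs S)" "holds1 \<alpha> 8 (enc_trs R)"
      "holds1 \<alpha> 8 (enc_trs S)"
      using n by (auto simp: model_simps[OF m])
    show "\<not> (holds1 \<alpha> 14 (\<alpha> 13) \<and> chain \<alpha> (enc_trs R) (enc_trs S))"
      using chain_imp_not_SN[OF m] n(4) unfolding SN_rel_def model_simps[OF m] by blast
  qed
next
  fix n assume sat: "\<forall>\<alpha>. asat \<alpha> [n] pairs_fm"
  obtain \<alpha> where m: "model \<alpha>"
    using model_exists by blast
  obtain R S where n: "n = prod_encode (enc_trs R, enc_trs S)" "wf_trs R" "wf_trs S"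
    using sat[rule_format, of \<alpha>] m unfolding asat_pairs_fm by (auto simp: model_simps[OF m])
  have "SN_rel_on R S t" for t
  proof (rule ccontr)
    assume "\<not> SN_rel_on R S t"
    then obtain \<beta> where \<beta>: "model \<beta>" "\<beta> 13 = enc_trm t" "chain \<beta> (enc_trs R) (enc_trs S)"
      using not_SN_imp_chain by blast
    then show False
      using sat[rule_format, of \<beta>] unfolding asat_pairs_fm
      by (auto simp: model_simps[OF \<beta>(1)] n)
  qed
  then show "n \<in> SN_pairs"
    using n unfolding SN_pairs_def SN_rel_def by blast
qed

theorem theorem7:
  shows "Pi11_complete SN_triples \<and> Pi11_complete SN_pairs \<and>
         Pi11_hard SN_self_on \<and> Pi11_hard SN_self"
  unfolding Pi11_complete_def
  using Pi11_triples Pi11_pairs Pi11_hard_triples Pi11_hard_pairs Pi11_hard_self_on Pi11_hard_self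
  by blast

end
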